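(* Let $X$ be a compact metrizable group, $A_0,\dots,A_{m-1}$ surjective endomorphisms of $X$ ($m\ge1$) and $a_0,\dots,a_{m-1}\in X$. Let $\mu$ be the normalised Haar measure on $X$ and $d$ a left-invariant metric on $X$ (inducing its topology). Let $g_i=a_i\cdot A_i$, i.e. $g_i(x)=a_i\cdot A_i(x)$, for $0\le i\le m-1$. Then \[\lim_{\varepsilon\to0}\limsup_{n\to\infty}\left[\frac1n\left(\frac1{m^n}\sum_{|w|=n}\log\frac1{\mu(D_w(e,\varepsilon,A_0,\dots,A_{m-1}))}\right)\right]\le h_\mu(g_0,\dots,g_{m-1})\] and \[h_\mu(g_0,\dots,g_{m-1})\le\lim_{\varepsilon\to0}\limsup_{n\to\infty}\left[\frac1n\log\left(\frac1{m^n}\sum_{|w|=n}\frac1{\mu(D_w(e,\varepsilon,A_0,\dots,A_{m-1}))}\right)\right],\] where \[D_w(e,\varepsilon,A_0,\dots,A_{m-1})=\bigcap_{w'\le w}A_{w'}^{-1}(B_d(e,\varepsilon)),\] $e$ is the identity element of $X$ and $B_d(e,\varepsilon)$ is the open ball with center $e$ and radius $\varepsilon$ with respect to $d$. In particular, \[\lim_{\varepsilon\to0}\limsup_{n\to\infty}\left[\frac1n\left(\frac1{m^n}\sum_{|w|=n}\log\frac1{\mu(D_w(e,\varepsilon,A_0,\dots,A_{m-1}))}\right)\right]\le h_\mu(A_0,\dots,A_{m-1})\] and \[h_\mu(A_0,\dots,A_{m-1})\le\lim_{\varepsilon\to0}\limsup_{n\to\infty}\left[\frac1n\log\left(\fr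ac1{m^n}\sum_{|w|=n}\frac1{\mu(D_w(e,\varepsilon,A_0,\dots,A_{m-1}))}\right)\right].\]
   Context: Endomorphisms of $X$ are continuous group homomorphisms $X\to X$. Words. $F_m^+$ is the set of finite words in the symbols $0,1,\dots,m-1$; $|w|$ is the length of $w$; sums $\sum_{|w|=n}$ run over the $m^n$ words of length $n$. Write $w'\le w$ if $w=w''w'$ for some nonempty word $w''$, where $w'$ may be empty; thus if $|w|=n$, the words $w'\le w$ are the $n$ suffixes of $w$ of lengths $0,1,\dots,n-1$. For self-maps $f_0,\dots,f_{m-1}$ of $X$ and $w=w_1w_2\cdots w_k$ put $f_w=f_{w_1}\circ f_{w_2}\circ\cdots\circ f_{w_k}$, with $f_w=\mathrm{id}$ for the empty word; $f_w^{-1}$ denotes preimage. ($A_w$ is defined in the same way from $A_0,\dots,A_{m-1}$.) Measure-theoretic entropy. For a finite measurable partition $\xi=\{C_1,\dots,C_k\}$ of a probability space, $H_\mu(\xi)=-\sum_i\mu(C_i)\log\mu(C_i)$ (with $0\log0=0$); $\xi\vee\eta$ is the partition into intersections $A\cap C$, $A\in\xi$, $C\in\eta$; $f^{-1}\xi=\{f^{-1}A:A\in\xi\}$. For measure-preserving maps $f_0,\dots,f_{m-1}$, $h_\mu(f_0,\dots,f_{m-1},\xi)=\lim_{n\to\infty}\frac1n\Big[\frac1{m^n}\sum_{|w|=n}H_\mu\big(\bigvee_{w'\le w}f_{w'}^{-1}\xi\big)\Big]$ (this limit exists), and $h_\mu(f_0,\dots,f_{m-1})=\sup_\xi h_\mu(f_0,\dots,f_{m-1},\xi)$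 over all finite measurable partitions $\xi$. *)

theory Defs
  imports "HOL-Probability.Probability" "HOL-Library.Sublist"
begin

text \<open>
  The class \<open>topological_group_add\<close> extends \<open>group_add\<close>, whose operation is not assumed
  commutative.  So an arbitrary topological group is written additively: \<open>x + y\<close> is the product,
  \<open>0\<close> the identity element and \<open>- x\<close> the inverse.
\<close>

definition group_endomorphism :: "('a::topological_group_add \<Rightarrow> 'a) \<Rightarrow> bool" where
  "group_endomorphism f \<longleftrightarrow> continuous_on UNIV f \<and> (\<forall>x y. f (x + y) = f x + f y)"

text \<open>
  On a compact metrizable space every finite Borel measure is regular, so regularity is not
  part of the definition.
\<close>

definition normalised_haar :: "'a::topological_group_add measure \<Rightarrow> bool" where
  "normalised_haar M \<longleftrightarrow>
     prob_space M \<and> sets M = sets borel \<and> (\<forall>a. distr M M (\<lambda>x. a + x) = M)"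

definition left_invariant_metric :: "('a::topological_group_add \<Rightarrow> 'a \<Rightarrow> real) \<Rightarrow> bool" where
  "left_invariant_metric d \<longleftrightarrow>
     Metric_space UNIV d \<and> Metric_space.mtopology UNIV d = euclidean \<and>
     (\<forall>a x y. d (a + x) (a + y) = d x y)"


definition words :: "nat \<Rightarrow> nat \<Rightarrow> nat list set" where
  "words m n = {w. length w = n \<and> set w \<subseteq> {..<m}}"

primrec word_map :: "(nat \<Rightarrow> 'a \<Rightarrow> 'a) \<Rightarrow> nat list \<Rightarrow> 'a \<Rightarrow> 'a" where
  "word_map f [] = id"
| "word_map f (i # w) = f i \<circ> word_map f w"

text \<open>
  The empty word is a proper suffix of every nonempty word, and \<open>w\<close> is not one of itself.
\<close>

definition proper_suffixes :: "nat list \<Rightarrow> nat list set" where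
  "proper_suffixes w = {w'. strict_suffix w' w}"

lemma mem_proper_suffixes_iff:
  "w' \<in> proper_suffixes w \<longleftrightarrow> (\<exists>w''. w'' \<noteq> [] \<and> w = w'' @ w')"
  by (auto simp: proper_suffixes_def strict_suffix_def suffix_def)


text \<open>Empty blocks are allowed; they contribute nothing to the entropy.\<close>

definition finite_measurable_partition :: "'a measure \<Rightarrow> 'a set set \<Rightarrow> bool" where
  "finite_measurable_partition M \<xi> \<longleftrightarrow>
     finite \<xi> \<and> \<xi> \<subseteq> sets M \<and> disjoint \<xi> \<and> \<Union>\<xi> = space M"

definition partition_entropy :: "'a measure \<Rightarrow> 'a set set \<Rightarrow> real" where
  "partition_entropy M \<xi> = - (\<Sum>C\<in>\<xi>. measure M C * ln (measure M C))"

definition preimage_partition :: "('a \<Rightarrow> 'b) \<Rightarrow> 'b set set \<Rightarrow> 'a set set" where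
  "preimage_partition f \<xi> = (\<lambda>C. f -` C) ` \<xi>"

text \<open>
  The join of a family of partitions, indexed by \<open>I\<close>; the lemma below shows that it iterates the
  binary join of intersections \<open>A \<inter> C\<close>.
\<close>

definition partition_join :: "'i set \<Rightarrow> ('i \<Rightarrow> 'a set set) \<Rightarrow> 'a set set" where
  "partition_join I P = {(\<Inter>i\<in>I. c i) | c. \<forall>i\<in>I. c i \<in> P i}"

lemma partition_join_empty: "partition_join {} P = {UNIV}"
  by (simp add: partition_join_def)

lemma partition_join_insert:
  assumes "i \<notin> I"
  shows "partition_join (insert i I) P = {A \<inter> C | A C. A \<in> P i \<and> C \<in> partition_join I P}"
proof (intro set_eqI iffI)
  fix S assume "S \<in> partition_join (insert i I) P"
  then show "S \<in> {A \<inter> C | A C. A \<in> P i \<and> C \<in> partition_join I P}"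
    by (auto simp: partition_join_def)
next
  fix S assume "S \<in> {A \<inter> C | A C. A \<in> P i \<and> C \<in> partition_join I P}"
  then obtain A c where A: "A \<in> P i" and c: "\<forall>j\<in>I. c j \<in> P j"
    and S: "S = A \<inter> (\<Inter>j\<in>I. c j)"
    by (auto simp: partition_join_def)
  have "S = (\<Inter>j\<in>insert i I. (c(i := A)) j)"
    using assms by (auto simp: S simp del: INT_simps split: if_splits)
  moreover have "\<forall>j\<in>insert i I. (c(i := A)) j \<in> P j"
    using A c by auto
  ultimately show "S \<in> partition_join (insert i I) P"
    unfolding partition_join_def by blast
qed

definition semigroup_entropy_wrt ::
    "'a measure \<Rightarrow> nat \<Rightarrow> (nat \<Rightarrow> 'a \<Rightarrow> 'a) \<Rightarrow> 'a set set \<Rightarrow> real" where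
  "semigroup_entropy_wrt M m f \<xi> =
     lim (\<lambda>n. 1 / real n * (1 / real m ^ n *
       (\<Sum>w\<in>words m n. partition_entropy M
          (partition_join (proper_suffixes w) (\<lambda>w'. preimage_partition (word_map f w') \<xi>)))))"

definition semigroup_entropy :: "'a measure \<Rightarrow> nat \<Rightarrow> (nat \<Rightarrow> 'a \<Rightarrow> 'a) \<Rightarrow> ereal" where
  "semigroup_entropy M m f =
     (SUP \<xi>\<in>{\<xi>. finite_measurable_partition M \<xi>}. ereal (semigroup_entropy_wrt M m f \<xi>))"


definition D_set ::
    "('a::topological_group_add \<Rightarrow> 'a \<Rightarrow> real) \<Rightarrow> nat list \<Rightarrow> real \<Rightarrow> (nat \<Rightarrow> 'a \<Rightarrow> 'a) \<Rightarrow> 'a set" where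
  "D_set d w \<epsilon> A =
     (\<Inter>w'\<in>proper_suffixes w. word_map A w' -` Metric_space.mball UNIV d 0 \<epsilon>)"

definition lower_rate ::
    "('a::topological_group_add \<Rightarrow> 'a \<Rightarrow> real) \<Rightarrow> 'a measure \<Rightarrow> nat \<Rightarrow> (nat \<Rightarrow> 'a \<Rightarrow> 'a) \<Rightarrow> real \<Rightarrow> ereal"
  where
  "lower_rate d M m A \<epsilon> =
     limsup (\<lambda>n. ereal (1 / real n * (1 / real m ^ n *
       (\<Sum>w\<in>words m n. ln (1 / measure M (D_set d w \<epsilon> A))))))"

definition upper_rate ::
    "('a::topological_group_add \<Rightarrow> 'a \<Rightarrow> real) \<Rightarrow> 'a measure \<Rightarrow> nat \<Rightarrow> (nat \<Rightarrow> 'a \<Rightarrow> 'a) \<Rightarrow> real \<Rightarrow> ereal"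
  where
  "upper_rate d M m A \<epsilon> =
     limsup (\<lambda>n. ereal (1 / real n * ln (1 / real m ^ n *
       (\<Sum>w\<in>words m n. 1 / measure M (D_set d w \<epsilon> A)))))"

end

theory Submission
  imports Defs
begin

text \<open>
  Write \<open>h\<close> for the entropy of the affine maps and \<open>L\<close>, \<open>U\<close> for the limits of the lower and the upper
  rate.  The proof shows \<open>h = L\<close>; then \<open>L \<le> U\<close> is concavity of the logarithm.  Both limits exist
  because the rates are antitone in \<open>\<epsilon>\<close>.  The endomorphisms are the affine maps with trivial
  translations, and the rates do not involve the translations, so one argument serves both claims.

  The affine maps preserve Haar measure: the image of Haar measure under a surjective endomorphism is
  again left invariant, and a left-invariant probability measure is unique
  (\<open>surjective_endomorphism_preserves_haar\<close>).  By left invariance of \<open>d\<close>, the points whose orbits along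
  the word \<open>w\<close> stay within \<open>\<epsilon>\<close> of the orbit of \<open>x\<close> form the left translate by \<open>x\<close> of \<open>D_set d w \<epsilon> A\<close>.
  Thus all Bowen balls along \<open>w\<close> of radius \<open>\<epsilon>\<close> have the same measure \<open>p\<close>.

  \<open>L \<le> h\<close>: take a finite partition into sets of diameter less than \<open>\<epsilon>\<close>.  Every block of its join along
  \<open>w\<close> lies in a Bowen ball, so the join has entropy at least \<open>ln (1 / p)\<close>
  (\<open>shannon_entropy_itinerary_ge\<close>).

  \<open>h \<le> L\<close>: let \<open>\<xi>\<close> be any finite partition.  A maximal family of disjoint Bowen balls has at most
  \<open>1 / p\<close> members, and the balls of twice the radius around their centres cover the group.  Naming such
  a ball costs entropy at most \<open>ln (1 / p)\<close> and locates the whole orbit segment along \<open>w\<close> up to a small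
  error.  This fails to determine the blocks of \<open>\<xi>\<close> visited by the orbit only near the boundaries of
  the blocks.  To repair it, shrink the blocks to closed sets whose union \<open>Y\<close> has almost full measure;
  these have positive mutual distance.  Recording at each step whether the point is in \<open>Y\<close>, and its
  block if it is not, costs an arbitrarily small entropy per letter and suffices to recover the block
  (\<open>robust_coding\<close>, \<open>shannon_entropy_itinerary_block_le\<close>).  So the join of \<open>\<xi>\<close> along \<open>w\<close> has entropy at
  most \<open>ln (1 / p)\<close> plus a small multiple of the length of \<open>w\<close>.
\<close>

section \<open>Shannon entropy of finite-valued labels\<close>

text \<open>
  A finite partition is represented by a label, a simple function with any values whose level sets
  are the blocks.  Joins of partitions become pairs or lists of labels, and refinement becomes
  functional dependence, so the laws of entropy for simple random variables apply directly.
\<close>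

definition shannon_entropy :: "'a measure \<Rightarrow> ('a \<Rightarrow> 'b) \<Rightarrow> real" where
  "shannon_entropy M X =
     - (\<Sum>v\<in>X ` space M. measure M (X -` {v} \<inter> space M) * ln (measure M (X -` {v} \<inter> space M)))"

lemma shannon_entropy_cong:
  assumes "\<And>x. x \<in> space M \<Longrightarrow> X x = Y x"
  shows "shannon_entropy M X = shannon_entropy M Y"
proof -
  have "X ` space M = Y ` space M" "\<And>v. X -` {v} \<inter> space M = Y -` {v} \<inter> space M"
    using assms by auto
  then show ?thesis
    by (simp add: shannon_entropy_def)
qed

context prob_space
begin

lemma information_space_exp: "information_space M (exp 1)"
  by unfold_locales auto

lemma entropy_eq_shannon_entropy:
  assumes "simple_function M X"
  shows "entropy (exp 1) (count_space (X ` space M)) X = shannon_entropy M X"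
proof -
  interpret information_space M "exp 1"
    by (rule information_space_exp)
  show ?thesis
    using entropy_simple_distributed[OF simple_distributedI[OF assms measure_nonneg refl]]
    by (simp add: shannon_entropy_def log_def)
qed

lemma shannon_entropy_le_of_determines:
  assumes Y: "simple_function M Y"
    and det: "\<And>x y. x \<in> space M \<Longrightarrow> y \<in> space M \<Longrightarrow> Y x = Y y \<Longrightarrow> X x = X y"
  shows "shannon_entropy M X \<le> shannon_entropy M Y"
proof -
  interpret information_space M "exp 1"
    by (rule information_space_exp)
  define F where "F = X \<circ> inv_into (space M) Y"
  have "shannon_entropy M X = shannon_entropy M (F \<circ> Y)"
  proof (rule shannon_entropy_cong)
    fix x assume "x \<in> space M"
    then show "X x = (F \<circ> Y) x"
      using det[of x "inv_into (space M) Y (Y x)"]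
      by (simp add: F_def inv_into_into f_inv_into_f)
  qed
  also have "\<dots> \<le> shannon_entropy M Y"
    using entropy_data_processing[OF Y, of F]
    unfolding entropy_eq_shannon_entropy[OF Y]
      entropy_eq_shannon_entropy[OF simple_function_compose[OF Y, of F]] .
  finally show ?thesis .
qed

lemma shannon_entropy_Pair_le:
  assumes X: "simple_function M X" and Y: "simple_function M Y"
  shows "shannon_entropy M (\<lambda>x. (X x, Y x)) \<le> shannon_entropy M X + shannon_entropy M Y"
proof -
  interpret information_space M "exp 1"
    by (rule information_space_exp)
  show ?thesis
    using entropy_chain_rule[OF X Y] conditional_entropy_less_eq_entropy[OF Y X]
    by (simp add: entropy_eq_shannon_entropy X Y)
qed

lemma shannon_entropy_le_ln_card:
  assumes X: "simple_function M X"
  shows "shannon_entropy M X \<le> ln (card (X ` space M))"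
proof -
  interpret information_space M "exp 1"
    by (rule information_space_exp)
  show ?thesis
    using entropy_le_card[OF simple_distributedI[OF X measure_nonneg refl]]
    by (simp add: entropy_eq_shannon_entropy X log_def)
qed

lemma sum_measure_level_sets:
  assumes X: "simple_function M X"
  shows "(\<Sum>v\<in>X ` space M. measure M (X -` {v} \<inter> space M)) = 1"
proof -
  have "(\<Sum>v\<in>X ` space M. measure M (X -` {v} \<inter> space M))
      = measure M (\<Union>v\<in>X ` space M. X -` {v} \<inter> space M)"
    by (rule finite_measure_finite_Union[symmetric])
      (use X in \<open>auto simp: simple_functionD disjoint_family_on_def\<close>)
  also have "(\<Union>v\<in>X ` space M. X -` {v} \<inter> space M) = space M"
    by auto
  finally show ?thesis
    by (simp add: prob_space)
qed

text \<open>
  Each term of the entropy is \<open>q * ln (1 / q)\<close>, with \<open>q\<close> the measure of a level set, and the \<open>q\<close> sum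
  to \<open>1\<close>: the entropy is the mean of \<open>ln (1 / q)\<close>.
\<close>

lemma shannon_entropy_ge_of_level_sets_le:
  assumes X: "simple_function M X"
    and le: "\<And>x. x \<in> space M \<Longrightarrow> measure M (X -` {X x} \<inter> space M) \<le> p"
  shows "ln (1 / p) \<le> shannon_entropy M X"
proof -
  let ?q = "\<lambda>v. measure M (X -` {v} \<inter> space M)"
  have "?q v * ln (1 / p) \<le> - (?q v * ln (?q v))" if "v \<in> X ` space M" for v
  proof (cases "?q v = 0")
    case False
    then have pos: "0 < ?q v"
      by (simp add: zero_less_measure_iff)
    moreover have "?q v \<le> p"
      using le that by auto
    ultimately have "ln (1 / p) \<le> - ln (?q v)"
      by (simp add: ln_div)
    from mult_left_mono[OF this, of "?q v"] show ?thesis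
      by simp
  qed simp
  then have "(\<Sum>v\<in>X ` space M. ?q v * ln (1 / p)) \<le> (\<Sum>v\<in>X ` space M. - (?q v * ln (?q v)))"
    by (rule sum_mono)
  then show ?thesis
    by (simp add: shannon_entropy_def sum_negf sum_measure_level_sets[OF X] flip: sum_distrib_right)
qed

lemma shannon_entropy_nonneg:
  assumes X: "simple_function M X"
  shows "0 \<le> shannon_entropy M X"
  using shannon_entropy_ge_of_level_sets_le[OF X, of 1] by simp

lemma shannon_entropy_measure_preserving:
  assumes X: "simple_function M X" and T: "T \<in> measurable M M" and inv: "distr M M T = M"
  shows "shannon_entropy M (\<lambda>x. X (T x)) = shannon_entropy M X"
proof -
  have XT: "(\<lambda>x. X (T x)) -` {v} \<inter> space M = T -` (X -` {v} \<inter> space M) \<inter> space M" for v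
    using measurable_space[OF T] by auto
  have eq: "measure M ((\<lambda>x. X (T x)) -` {v} \<inter> space M) = measure M (X -` {v} \<inter> space M)" for v
    using measure_distr[OF T, of "X -` {v} \<inter> space M"] simple_functionD(2)[OF X, of "{v}"]
    by (simp add: inv XT)
  have "(\<Sum>v\<in>(\<lambda>x. X (T x)) ` space M. measure M (X -` {v} \<inter> space M) * ln (measure M (X -` {v} \<inter> space M)))
      = (\<Sum>v\<in>X ` space M. measure M (X -` {v} \<inter> space M) * ln (measure M (X -` {v} \<inter> space M)))"
  proof (rule sum.mono_neutral_left)
    show "finite (X ` space M)"
      using X by (rule simple_functionD)
    show "(\<lambda>x. X (T x)) ` space M \<subseteq> X ` space M"
      using measurable_space[OF T] by auto
    show "\<forall>v\<in>X ` space M - (\<lambda>x. X (T x)) ` space M.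
        measure M (X -` {v} \<inter> space M) * ln (measure M (X -` {v} \<inter> space M)) = 0"
    proof
      fix v assume "v \<in> X ` space M - (\<lambda>x. X (T x)) ` space M"
      then have "(\<lambda>x. X (T x)) -` {v} \<inter> space M = {}"
        by (auto simp: image_iff)
      then show "measure M (X -` {v} \<inter> space M) * ln (measure M (X -` {v} \<inter> space M)) = 0"
        using eq[of v] by simp
    qed
  qed
  then show ?thesis
    unfolding shannon_entropy_def eq by simp
qed

text \<open>
  The passage from partitions to labels.  Empty blocks are no level sets of \<open>X\<close>, but they contribute
  nothing to the partition entropy.
\<close>

lemma partition_entropy_eq_shannon_entropy:
  assumes block: "\<And>C x. C \<in> P \<Longrightarrow> x \<in> C \<Longrightarrow> X -` {X x} \<inter> space M = C"
    and cover: "\<And>x. x \<in> space M \<Longrightarrow> \<exists>C\<in>P. x \<in> C"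
    and fin: "finite (X ` space M)"
  shows "partition_entropy M P = shannon_entropy M X"
proof -
  let ?level = "\<lambda>v. X -` {v} \<inter> space M"
  have im: "?level ` (X ` space M) = P - {{}}"
  proof (intro equalityI subsetI)
    fix S assume "S \<in> ?level ` (X ` space M)"
    then show "S \<in> P - {{}}"
      using block cover by fastforce
  next
    fix S assume S: "S \<in> P - {{}}"
    then obtain x where "x \<in> S"
      by auto
    then show "S \<in> ?level ` (X ` space M)"
      using S block[of S x] by auto
  qed
  have inj: "inj_on ?level (X ` space M)"
    by (auto simp: inj_on_def)
  have "finite (P - {{}})"
    unfolding im[symmetric] using fin by simp
  then have "(\<Sum>C\<in>P. measure M C * ln (measure M C)) = (\<Sum>C\<in>P - {{}}. measure M C * ln (measure M C))"
    by (intro sum.mono_neutral_right) auto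
  also have "\<dots> = (\<Sum>v\<in>X ` space M. measure M (?level v) * ln (measure M (?level v)))"
    unfolding im[symmetric] by (subst sum.reindex[OF inj]) (simp add: o_def)
  finally show ?thesis
    by (simp add: partition_entropy_def shannon_entropy_def)
qed

end

lemma entropy_summand_small:
  fixes \<kappa> :: real
  assumes "\<kappa> > 0"
  obtains \<delta> where "\<delta> > 0" "\<And>t. 0 \<le> t \<Longrightarrow> t < \<delta> \<Longrightarrow> - (t * ln t) \<le> \<kappa>"
proof -
  \<comment> \<open>From \<open>ln (1 / sqrt t) \<le> 1 / sqrt t\<close> one gets \<open>- t * ln t \<le> 2 * sqrt t\<close>.\<close>
  show thesis
  proof
    show "0 < (\<kappa> / 2)\<^sup>2"
      using assms by simp
    fix t :: real
    assume t: "0 \<le> t" "t < (\<kappa> / 2)\<^sup>2"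
    show "- (t * ln t) \<le> \<kappa>"
    proof (cases "t = 0")
      case False
      then have "0 < sqrt t"
        using t by simp
      then have "- ln t / 2 \<le> 1 / sqrt t"
        using ln_le_minus_one[of "1 / sqrt t"] t False by (simp add: ln_div ln_sqrt)
      from mult_left_mono[OF this, of "2 * t"] have "- (t * ln t) \<le> 2 * (t / sqrt t)"
        using t by simp
      also have "t / sqrt t = sqrt t"
        using t by (simp add: real_div_sqrt)
      also have "sqrt t \<le> \<kappa> / 2"
        using t assms by (intro real_le_lsqrt) auto
      finally show ?thesis
        by simp
    qed (use assms in simp)
  qed
qed

text \<open>
  A label that takes one value \<open>v\<close> outside a set of small measure carries little information, uniformly
  over all labels with at most \<open>N\<close> values: \<open>- t * ln t\<close> is small near \<open>t = 0\<close> and near \<open>t = 1\<close>.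
\<close>

lemma (in prob_space) shannon_entropy_nearly_constant:
  fixes \<kappa> :: real and N :: nat
  assumes "\<kappa> > 0"
  obtains \<delta> where "\<delta> > 0"
    "\<And>X. simple_function M X \<Longrightarrow> card (X ` space M) \<le> N \<Longrightarrow> measure M {x \<in> space M. X x \<noteq> v} < \<delta>
       \<Longrightarrow> shannon_entropy M X \<le> \<kappa>"
proof -
  obtain \<delta> where \<delta>: "\<delta> > 0" "\<And>t. 0 \<le> t \<Longrightarrow> t < \<delta> \<Longrightarrow> - (t * ln t) \<le> \<kappa> / (2 * (real N + 1))"
    using entropy_summand_small[of "\<kappa> / (2 * (real N + 1))"] assms by auto
  show thesis
  proof
    show "0 < min \<delta> (\<kappa> / 2)"
      using \<delta> assms by simp
    fix X :: "'a \<Rightarrow> 'b"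
    assume X: "simple_function M X" and N: "card (X ` space M) \<le> N"
      and off: "measure M {x \<in> space M. X x \<noteq> v} < min \<delta> (\<kappa> / 2)"
    let ?q = "\<lambda>u. measure M (X -` {u} \<inter> space M)"
    have fin: "finite (X ` space M)" and meas: "\<And>B. X -` B \<inter> space M \<in> sets M"
      using X by (auto simp: simple_functionD)
    have offset: "{x \<in> space M. X x \<noteq> v} = X -` (- {v}) \<inter> space M"
      by auto
    have other: "- (?q u * ln (?q u)) \<le> \<kappa> / (2 * (real N + 1))" if "u \<noteq> v" for u
    proof (rule \<delta>(2))
      have "?q u \<le> measure M {x \<in> space M. X x \<noteq> v}"
        by (rule finite_measure_mono) (use that meas[of "- {v}"] in \<open>auto simp: offset\<close>)
      then show "?q u < \<delta>"
        using off by simp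
    qed simp
    have main: "- (?q v * ln (?q v)) \<le> \<kappa> / 2"
    proof (cases "?q v = 0")
      case False
      then have pos: "0 < ?q v"
        by (simp add: zero_less_measure_iff)
      have "- ln (?q v) \<le> 1 / ?q v - 1"
        using ln_le_minus_one[of "1 / ?q v"] pos by (simp add: ln_div)
      from mult_left_mono[OF this, of "?q v"] pos have "- (?q v * ln (?q v)) \<le> 1 - ?q v"
        by (simp add: algebra_simps)
      also have "1 - ?q v = measure M (space M - (X -` {v} \<inter> space M))"
        by (rule prob_compl[symmetric]) (rule meas)
      also have "space M - (X -` {v} \<inter> space M) = {x \<in> space M. X x \<noteq> v}"
        by auto
      finally show ?thesis
        using off by simp
    qed (use assms in simp)
    have "shannon_entropy M X = (\<Sum>u\<in>X ` space M. - (?q u * ln (?q u)))"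
      by (simp add: shannon_entropy_def sum_negf)
    also have "\<dots> \<le> (\<Sum>u\<in>X ` space M. (if u = v then \<kappa> / 2 else 0) + \<kappa> / (2 * (real N + 1)))"
      using main other assms by (intro sum_mono) (auto simp: add_increasing2)
    also have "\<dots> \<le> \<kappa> / 2 + real (card (X ` space M)) * (\<kappa> / (2 * (real N + 1)))"
      using fin assms by (simp add: sum.distrib)
    also have "\<dots> \<le> \<kappa> / 2 + real N * (\<kappa> / (2 * (real N + 1)))"
      using N assms by (intro add_left_mono mult_right_mono) auto
    also have "\<dots> \<le> \<kappa>"
      using assms by (simp add: field_simps)
    finally show "shannon_entropy M X \<le> \<kappa>" .
  qed
qed

section \<open>Approximation of Borel sets by closed and open sets\<close>

text \<open>
  A closed set is the decreasing intersection of its open \<open>1 / (n + 1)\<close>-neighbourhoods.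
\<close>

lemma closed_open_approximation_of_closed:
  fixes F :: "'a::metric_space set"
  assumes fin: "finite_measure M" and M: "sets M = sets borel"
    and F: "closed F" and e: "e > 0"
  shows "\<exists>U. open U \<and> F \<subseteq> U \<and> measure M (U - F) < e"
proof (cases "F = {}")
  case True
  then show ?thesis
    using e by (intro exI[of _ "{}"]) auto
next
  case False
  interpret finite_measure M by fact
  define U where "U n = {x. infdist x F < 1 / real (Suc n)}" for n
  have U_open: "open (U n)" for n
    unfolding U_def by (intro open_Collect_less continuous_intros)
  have [measurable]: "U n \<in> sets M" "F \<in> sets M" for n
    using U_open[of n] F by (auto simp: M)
  have FU: "F \<subseteq> U n" for n
    by (auto simp: U_def)
  have "(\<Inter>n. U n - F) = {}"
  proof (rule ccontr)
    assume "\<not> ?thesis"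
    then obtain x where x: "x \<notin> F" "\<And>n. infdist x F < 1 / real (Suc n)"
      by (auto simp: U_def)
    then have "infdist x F > 0"
      using F False infdist_pos_not_in_closed by blast
    then show False
      using x(2) reals_Archimedean[of "infdist x F"] by (metis inverse_eq_divide order_less_asym)
  qed
  then have inter: "\<Inter> (range U) - F = {}"
    by auto
  have "decseq (\<lambda>n. U n - F)"
  proof (rule decseq_SucI)
    fix n
    have "1 / real (Suc (Suc n)) \<le> 1 / real (Suc n)"
      by (intro divide_left_mono) auto
    then show "U (Suc n) - F \<subseteq> U n - F"
      unfolding U_def by force
  qed
  then have "(\<lambda>n. measure M (U n - F)) \<longlonglongrightarrow> measure M {}"
    using finite_Lim_measure_decseq[of "\<lambda>n. U n - F"] by (simp add: image_subset_iff inter)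
  from order_tendstoD(2)[OF this, of e] e obtain n where "measure M (U n - F) < e"
    by (auto simp: eventually_sequentially)
  then show ?thesis
    using U_open FU by blast
qed

text \<open>
  The sets that can be squeezed between a closed and an open set up to small measure form a
  \<open>\<sigma>\<close>-algebra.  For a countable union the open sets are united, with errors summing to at most
  half of the allowance, and all but finitely many of the closed sets are discarded at the cost of
  the other half.
\<close>

lemma borel_approximation_closed_open:
  fixes B :: "'a::metric_space set"
  assumes fin: "finite_measure M" and M: "sets M = sets borel"
    and B: "B \<in> sets borel" and e: "e > 0"
  shows "\<exists>F U. closed F \<and> open U \<and> F \<subseteq> B \<and> B \<subseteq> U \<and> measure M (U - F) < e"
proof -
  interpret finite_measure M by fact
  have "B \<in> sigma_sets UNIV (Collect closed)"
    using B by (simp add: borel_eq_closed)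
  then show ?thesis
    using e
  proof (induction B arbitrary: e)
    case (Basic B)
    then show ?case
      using closed_open_approximation_of_closed[OF fin M, of B e] by blast
  next
    case Empty
    then show ?case
      by (intro exI[of _ "{}"]) auto
  next
    case (Compl B)
    then obtain F U where "closed F" "open U" "F \<subseteq> B" "B \<subseteq> U" "measure M (U - F) < e"
      by meson
    moreover have "- F - - U = U - F"
      by auto
    ultimately show ?case
      by (intro exI[of _ "- U"] exI[of _ "- F"]) auto
  next
    case (Union B)
    have "\<exists>F U. closed F \<and> open U \<and> F \<subseteq> B n \<and> B n \<subseteq> U \<and> measure M (U - F) < e / 4 * (1/2)^n" for n
      using Union.prems by (intro Union.IH) auto
    then obtain F U where FU: "\<And>n. closed (F n)" "\<And>n. open (U n)" "\<And>n. F n \<subseteq> B n" "\<And>n. B n \<subseteq> U n"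
        "\<And>n. measure M (U n - F n) < e / 4 * (1/2)^n"
      by metis
    have [measurable]: "F n \<in> sets M" "U n \<in> sets M" for n
      using FU by (auto simp: M)
    have Fmeas: "(\<Union>n. F n) \<in> sets M"
      by measurable
    have sums: "(\<lambda>n. e / 4 * (1/2)^n) sums (e / 4 * 2)"
      using geometric_sums[of "1/2::real"] by (intro sums_mult) simp
    have summ: "summable (\<lambda>n. measure M (U n - F n))"
      by (rule summable_comparison_test'[OF sums_summable[OF sums], of 0])
        (use FU(5) in \<open>auto intro: less_imp_le\<close>)
    have "measure M ((\<Union>n. U n) - (\<Union>n. F n)) \<le> measure M (\<Union>n. U n - F n)"
      by (rule finite_measure_mono) auto
    also have "\<dots> \<le> (\<Sum>n. measure M (U n - F n))"
      by (rule finite_measure_subadditive_countably) (use summ in auto)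
    also have "\<dots> \<le> (\<Sum>n. e / 4 * (1/2)^n)"
      using FU(5) by (intro suminf_le summ sums_summable[OF sums] less_imp_le)
    also have "\<dots> = e / 2"
      using sums_unique[OF sums] by simp
    finally have outer: "measure M ((\<Union>n. U n) - (\<Union>n. F n)) \<le> e / 2" .
    have "(\<lambda>N. measure M (\<Union>n<N. F n)) \<longlonglongrightarrow> measure M (\<Union>N. \<Union>n<N. F n)"
      by (rule finite_Lim_measure_incseq) (auto simp: incseq_def intro: less_le_trans)
    moreover have "(\<Union>N. \<Union>n<N. F n) = (\<Union>n. F n)"
      by auto
    ultimately have "(\<lambda>N. measure M (\<Union>n<N. F n)) \<longlonglongrightarrow> measure M (\<Union>n. F n)"
      by simp
    from order_tendstoD(1)[OF this, of "measure M (\<Union>n. F n) - e / 2"]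
    obtain N where N: "measure M (\<Union>n. F n) - e / 2 < measure M (\<Union>n<N. F n)"
      using Union.prems by (auto simp: eventually_sequentially)
    have "measure M ((\<Union>n. F n) - (\<Union>n<N. F n)) = measure M (\<Union>n. F n) - measure M (\<Union>n<N. F n)"
      by (rule finite_measure_Diff) auto
    then have inner: "measure M ((\<Union>n. F n) - (\<Union>n<N. F n)) < e / 2"
      using N by simp
    have "measure M ((\<Union>n. U n) - (\<Union>n<N. F n))
        \<le> measure M (((\<Union>n. U n) - (\<Union>n. F n)) \<union> ((\<Union>n. F n) - (\<Union>n<N. F n)))"
      by (rule finite_measure_mono) auto
    also have "\<dots> \<le> measure M ((\<Union>n. U n) - (\<Union>n. F n)) + measure M ((\<Union>n. F n) - (\<Union>n<N. F n))"
      by (rule measure_Un_le) auto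
    also have "\<dots> < e"
      using inner outer by simp
    finally have "measure M ((\<Union>n. U n) - (\<Union>n<N. F n)) < e" .
    moreover have "closed (\<Union>n<N. F n)" "open (\<Union>n. U n)"
      using FU by (auto intro!: closed_UN)
    moreover have "(\<Union>n<N. F n) \<subseteq> (\<Union>n. B n)" "(\<Union>n. B n) \<subseteq> (\<Union>n. U n)"
      using FU(3,4) by blast+
    ultimately show ?case
      by blast
  qed
qed

section \<open>Uniqueness of Haar measure on a compact metrizable group\<close>

lemma compact_metric_countable_base:
  assumes "compact (UNIV :: 'a::metric_space set)"
  obtains \<B> :: "'a::metric_space set set" where "countable \<B>" "\<And>b. b \<in> \<B> \<Longrightarrow> open b"
    "\<And>x U. open U \<Longrightarrow> x \<in> U \<Longrightarrow> \<exists>b\<in>\<B>. x \<in> b \<and> b \<subseteq> U"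
proof -
  have "\<exists>k. finite k \<and> (UNIV :: 'a set) \<subseteq> (\<Union>x\<in>k. ball x (1 / real (Suc n)))" for n
    using assms unfolding compact_eq_totally_bounded by auto
  then obtain k :: "nat \<Rightarrow> 'a set" where
    k: "\<And>n. finite (k n)" "\<And>n. UNIV \<subseteq> (\<Union>x\<in>k n. ball x (1 / real (Suc n)))"
    by metis
  let ?\<B> = "\<Union>n. (\<lambda>x. ball x (1 / real (Suc n))) ` k n"
  show thesis
  proof (rule that[of ?\<B>])
    show "countable ?\<B>"
      using k(1) by (intro countable_UN countable_image) (auto intro: countable_finite)
    show "open b" if "b \<in> ?\<B>" for b
      using that by auto
    fix x :: 'a and U :: "'a set"
    assume "open U" "x \<in> U"
    then obtain r where r: "r > 0" "ball x r \<subseteq> U"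
      using openE by blast
    obtain n where n: "1 / real (Suc n) < r / 2"
      using reals_Archimedean[of "r / 2"] r by (auto simp: inverse_eq_divide)
    obtain y where y: "y \<in> k n" "x \<in> ball y (1 / real (Suc n))"
      using k(2)[of n] by blast
    have "ball y (1 / real (Suc n)) \<subseteq> ball x r"
    proof
      fix z assume "z \<in> ball y (1 / real (Suc n))"
      then have "dist y z < r / 2" "dist y x < r / 2"
        using y n by auto
      then show "z \<in> ball x r"
        using dist_triangle_half_r[of y x r z] by (simp add: dist_commute)
    qed
    then show "\<exists>b\<in>?\<B>. x \<in> b \<and> b \<subseteq> U"
      using y r by (intro bexI[of _ "ball y (1 / real (Suc n))"]) auto
  qed
qed

text \<open>
  Joint Borel measurability of the group operation is what Fubini's theorem needs below.  Continuity
  only gives measurability for the Borel sets of the product; a countable base of \<open>X\<close> makes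
  every open set of the product a countable union of open boxes.
\<close>

lemma measurable_add_compact_metric_group:
  assumes "compact (UNIV :: 'a::{topological_group_add, metric_space} set)"
  shows "(\<lambda>(x :: 'a::{topological_group_add, metric_space}, y). x + y) \<in> measurable (borel \<Otimes>\<^sub>M borel) borel"
proof (rule borel_measurableI)
  obtain \<B> :: "'a set set" where B: "countable \<B>" "\<And>b. b \<in> \<B> \<Longrightarrow> open b"
    "\<And>x U. open U \<Longrightarrow> x \<in> U \<Longrightarrow> \<exists>b\<in>\<B>. x \<in> b \<and> b \<subseteq> U"
    using compact_metric_countable_base[OF assms] by blast
  fix S :: "'a set"
  assume S: "open S"
  let ?I = "{(b, c) \<in> \<B> \<times> \<B>. \<forall>x\<in>b. \<forall>y\<in>c. x + y \<in> S}"
  have "(\<lambda>(x :: 'a, y). x + y) -` S = (\<Union>(b, c)\<in>?I. b \<times> c)"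
  proof (intro equalityI subsetI)
    fix p assume "p \<in> (\<lambda>(x :: 'a, y). x + y) -` S"
    moreover obtain x y where p: "p = (x, y)"
      by (cases p)
    moreover have "open ((\<lambda>p. fst p + snd p) -` S)"
      by (intro open_vimage[OF S]) (intro continuous_intros)
    ultimately obtain V W where VW: "open V" "open W" "x \<in> V" "y \<in> W"
        "V \<times> W \<subseteq> (\<lambda>p. fst p + snd p) -` S"
      by (elim open_prod_elim[of _ "(x, y)"]) auto
    obtain b c where "b \<in> \<B>" "x \<in> b" "b \<subseteq> V" "c \<in> \<B>" "y \<in> c" "c \<subseteq> W"
      using B(3) VW by meson
    moreover from this have "\<forall>x\<in>b. \<forall>y\<in>c. x + y \<in> S"
      using VW by fastforce
    ultimately show "p \<in> (\<Union>(b, c)\<in>?I. b \<times> c)"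
      using p by blast
  qed auto
  moreover have "(\<Union>(b, c)\<in>?I. b \<times> c) \<in> sets (borel \<Otimes>\<^sub>M borel)"
  proof (rule sets.countable_UN')
    show "countable ?I"
      by (rule countable_subset[of _ "\<B> \<times> \<B>"]) (use B(1) in auto)
    show "(\<lambda>(b, c). b \<times> c) ` ?I \<subseteq> sets (borel \<Otimes>\<^sub>M borel)"
      using B(2) by auto
  qed
  ultimately show "(\<lambda>(x :: 'a, y). x + y) -` S \<inter> space (borel \<Otimes>\<^sub>M borel) \<in> sets (borel \<Otimes>\<^sub>M borel)"
    by (simp add: space_pair_measure)
qed

lemma borel_measurable_translation:
  fixes a :: "'a::topological_group_add"
  shows "(\<lambda>x. a + x) \<in> borel_measurable borel" "(\<lambda>x. x + a) \<in> borel_measurable borel"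
proof -
  show "(\<lambda>x. a + x) \<in> borel_measurable borel"
    by (rule borel_measurable_continuous_onI, rule continuous_on_add, rule continuous_on_const, rule continuous_on_id)
  show "(\<lambda>x. x + a) \<in> borel_measurable borel"
    by (rule borel_measurable_continuous_onI, rule continuous_on_add, rule continuous_on_id, rule continuous_on_const)
qed

text \<open>
  Both measures of \<open>B\<close> equal the double integral of the indicator of \<open>B\<close> at \<open>y + x\<close>: integrating first
  over \<open>x\<close> uses left invariance of \<open>M\<close>, integrating first over \<open>y\<close> uses right invariance of \<open>N\<close>.
\<close>

lemma left_invariant_eq_right_invariant:
  fixes M N :: "'a::{topological_group_add, metric_space} measure"
  assumes cpt: "compact (UNIV :: 'a set)"
    and M: "prob_space M" "sets M = sets borel" "\<And>a. distr M M (\<lambda>x. a + x) = M"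
    and N: "prob_space N" "sets N = sets borel" "\<And>a. distr N N (\<lambda>x. x + a) = N"
  shows "M = N"
proof (rule measure_eqI)
  show "sets M = sets N"
    using M N by simp
  fix B assume "B \<in> sets M"
  then have B[measurable]: "B \<in> sets borel"
    using M by simp
  interpret M: prob_space M by fact
  interpret N: prob_space N by fact
  interpret pair_sigma_finite N M ..
  have [measurable_cong]: "sets M = sets borel" "sets N = sets borel"
    using M N by auto
  have sp: "space M = UNIV" "space N = UNIV"
    using M(2) N(2) by (auto dest: sets_eq_imp_space_eq)
  note borel_measurable_translation[measurable]
  note measurable_add_compact_metric_group[OF cpt, measurable]
  have M': "(\<integral>\<^sup>+x. indicator B (y + x) \<partial>M) = emeasure M B" for y
  proof -
    have "emeasure M B = emeasure (distr M M (\<lambda>x. y + x)) B"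
      by (simp add: M)
    also have "\<dots> = emeasure M ((\<lambda>x. y + x) -` B \<inter> space M)"
      by (rule emeasure_distr) measurable
    also have "\<dots> = (\<integral>\<^sup>+x. indicator ((\<lambda>x. y + x) -` B \<inter> space M) x \<partial>M)"
      by (rule nn_integral_indicator[symmetric]) measurable
    also have "\<dots> = (\<integral>\<^sup>+x. indicator B (y + x) \<partial>M)"
      by (simp add: indicator_def vimage_def sp)
    finally show ?thesis ..
  qed
  have N': "(\<integral>\<^sup>+y. indicator B (y + x) \<partial>N) = emeasure N B" for x
  proof -
    have "emeasure N B = emeasure (distr N N (\<lambda>y. y + x)) B"
      by (simp add: N)
    also have "\<dots> = emeasure N ((\<lambda>y. y + x) -` B \<inter> space N)"
      by (rule emeasure_distr) measurable
    also have "\<dots> = (\<integral>\<^sup>+y. indicator ((\<lambda>y. y + x) -` B \<inter> space N) y \<partial>N)"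
      by (rule nn_integral_indicator[symmetric]) measurable
    also have "\<dots> = (\<integral>\<^sup>+y. indicator B (y + x) \<partial>N)"
      by (simp add: indicator_def vimage_def sp)
    finally show ?thesis ..
  qed
  have "emeasure M B = (\<integral>\<^sup>+y. \<integral>\<^sup>+x. indicator B (y + x) \<partial>M \<partial>N)"
    by (simp add: M' N.emeasure_space_1)
  also have "\<dots> = (\<integral>\<^sup>+x. \<integral>\<^sup>+y. indicator B (y + x) \<partial>N \<partial>M)"
  proof (rule Fubini'[symmetric])
    have "(\<lambda>p. indicator B (case p of (y, x) \<Rightarrow> y + x) :: ennreal) \<in> borel_measurable (N \<Otimes>\<^sub>M M)"
      by measurable
    then show "(\<lambda>(y, x). indicator B (y + x) :: ennreal) \<in> borel_measurable (N \<Otimes>\<^sub>M M)"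
      by (simp add: case_prod_beta')
  qed
  also have "\<dots> = emeasure N B"
    by (simp add: N' M.emeasure_space_1)
  finally show "emeasure M B = emeasure N B" .
qed

text \<open>
  The image of \<open>N\<close> under inversion is right invariant, so it equals every left-invariant probability
  measure, in particular \<open>M\<close> and \<open>N\<close>.
\<close>

lemma normalised_haar_unique:
  fixes M N :: "'a::{topological_group_add, metric_space} measure"
  assumes cpt: "compact (UNIV :: 'a set)" and M: "normalised_haar M" and N: "normalised_haar N"
  shows "M = N"
proof -
  define R where "R = distr N N uminus"
  have N': "prob_space N" "sets N = sets borel" "\<And>a. distr N N (\<lambda>x. a + x) = N"
    using N by (auto simp: normalised_haar_def)
  have M': "prob_space M" "sets M = sets borel" "\<And>a. distr M M (\<lambda>x. a + x) = M"
    using M by (auto simp: normalised_haar_def)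
  have meas: "uminus \<in> measurable N N" "(\<lambda>x. a + x) \<in> measurable N N" "(\<lambda>x. x + a) \<in> measurable N N" for a
    by (auto simp: measurable_cong_sets[OF N'(2) N'(2)]
        intro!: borel_measurable_continuous_onI continuous_intros)
  have R: "prob_space R" "sets R = sets borel"
    using N' prob_space.prob_space_distr[OF N'(1) meas(1)] by (auto simp: R_def)
  have right: "distr R R (\<lambda>x. x + a) = R" for a
  proof -
    have "distr R R (\<lambda>x. x + a) = distr (distr N N uminus) N (\<lambda>x. x + a)"
      unfolding R_def by (rule distr_cong) auto
    also have "\<dots> = distr N N ((\<lambda>x. x + a) \<circ> uminus)"
      by (rule distr_distr) (rule meas)+
    also have "(\<lambda>x. x + a) \<circ> uminus = uminus \<circ> (\<lambda>x. - a + x)"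
      by (simp add: fun_eq_iff minus_add)
    also have "distr N N (uminus \<circ> (\<lambda>x. - a + x)) = distr (distr N N (\<lambda>x. - a + x)) N uminus"
      by (rule distr_distr[symmetric]) (rule meas)+
    finally show ?thesis
      by (simp add: N' R_def)
  qed
  have "M = R"
    by (rule left_invariant_eq_right_invariant[OF cpt M' R right])
  moreover have "N = R"
    by (rule left_invariant_eq_right_invariant[OF cpt N' R right])
  ultimately show ?thesis
    by simp
qed

text \<open>
  The image measure is invariant under translation by \<open>b = f c\<close> because \<open>f\<close> carries the translation
  by \<open>c\<close> to that by \<open>b\<close>; by surjectivity every \<open>b\<close> is of this form, and Haar measure is unique.
\<close>

lemma surjective_endomorphism_preserves_haar:
  fixes M :: "'a::{topological_group_add, metric_space} measure"
  assumes cpt: "compact (UNIV :: 'a set)" and M: "normalised_haar M"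
    and f: "group_endomorphism f" "surj f"
  shows "distr M M f = M"
proof (rule normalised_haar_unique[OF cpt _ M])
  have M': "prob_space M" "sets M = sets borel" "\<And>a. distr M M (\<lambda>x. a + x) = M"
    using M by (auto simp: normalised_haar_def)
  have meas: "f \<in> measurable M M" "(\<lambda>x. a + x) \<in> measurable M M" for a
    using f by (auto simp: measurable_cong_sets[OF M'(2) M'(2)] group_endomorphism_def
        intro!: borel_measurable_continuous_onI continuous_intros)
  have "distr (distr M M f) (distr M M f) (\<lambda>x. b + x) = distr M M f" for b
  proof -
    obtain c where c: "b = f c"
      using f by (metis surj_def)
    have "distr (distr M M f) (distr M M f) (\<lambda>x. b + x) = distr (distr M M f) M (\<lambda>x. b + x)"
      by (rule distr_cong) auto
    also have "\<dots> = distr M M ((\<lambda>x. b + x) \<circ> f)"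
      by (rule distr_distr) (rule meas)+
    also have "(\<lambda>x. b + x) \<circ> f = f \<circ> (\<lambda>x. c + x)"
      using f by (simp add: fun_eq_iff c group_endomorphism_def)
    also have "distr M M (f \<circ> (\<lambda>x. c + x)) = distr (distr M M (\<lambda>x. c + x)) M f"
      by (rule distr_distr[symmetric]) (rule meas)+
    finally show ?thesis
      by (simp add: M')
  qed
  then show "normalised_haar (distr M M f)"
    using M' prob_space.prob_space_distr[OF M'(1) meas(1)] by (simp add: normalised_haar_def)
qed

section \<open>Coverings and packings by translates\<close>

text \<open>
  Disjointifies a finite cover: \<open>lab\<close> measurably chooses for each covered point a member containing it.
\<close>

lemma finite_cover_selector:
  assumes "finite E" and "\<And>e. e \<in> E \<Longrightarrow> V e \<in> sets M"
  shows "\<exists>lab. simple_function M lab \<and> (\<forall>x\<in>\<Union>e\<in>E. V e. lab x \<in> E \<and> x \<in> V (lab x))"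
  using assms
proof (induction E)
  case (insert e E)
  then obtain lab where lab: "simple_function M lab" "\<forall>x\<in>\<Union>e\<in>E. V e. lab x \<in> E \<and> x \<in> V (lab x)"
    by auto
  have "simple_function M (\<lambda>x. if x \<in> V e then e else lab x)"
    using insert.prems lab(1) by (intro simple_function_If_set) auto
  moreover have "\<forall>x\<in>\<Union>e\<in>insert e E. V e.
      (if x \<in> V e then e else lab x) \<in> insert e E \<and> x \<in> V (if x \<in> V e then e else lab x)"
    using lab(2) by auto
  ultimately show ?case
    by blast
next
  case empty
  show ?case
    by (rule exI[of _ "\<lambda>_. undefined"]) simp
qed

lemma haar_measure_translate:
  fixes M :: "'a::topological_group_add measure"
  assumes haar: "normalised_haar M" and D: "D \<in> sets borel"
  shows "(\<lambda>p. a + p) -` D \<in> sets M" "measure M ((\<lambda>p. a + p) -` D) = measure M D"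
proof -
  have M: "sets M = sets borel" "distr M M (\<lambda>x. a + x) = M"
    using haar by (auto simp: normalised_haar_def)
  then have sp: "space M = UNIV"
    by (auto dest: sets_eq_imp_space_eq)
  have meas: "(\<lambda>p. a + p) \<in> measurable M M"
    by (simp add: measurable_cong_sets[OF M(1) M(1)] borel_measurable_translation)
  show "(\<lambda>p. a + p) -` D \<in> sets M"
    using measurable_sets[OF meas, of D] D M(1) sp by simp
  show "measure M ((\<lambda>p. a + p) -` D) = measure M D"
    using measure_distr[OF meas, of D] D M sp by simp
qed

text \<open>
  A maximal family of pairwise disjoint translates of \<open>D\<close>.  Disjointness and invariance bound the
  number of translates by \<open>1 / measure M D\<close>, and by maximality every translate of \<open>D\<close> meets one of them.
\<close>

lemma haar_packing:
  fixes M :: "'a::topological_group_add measure"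
  assumes haar: "normalised_haar M" and D: "D \<in> sets borel" "0 < measure M D"
  obtains E where "finite E" "E \<noteq> {}" "real (card E) * measure M D \<le> 1"
    "\<And>y. \<exists>x\<in>E. \<exists>p. - x + p \<in> D \<and> - y + p \<in> D"
proof -
  interpret prob_space M
    using haar by (simp add: normalised_haar_def)
  define T where "T x = (\<lambda>p. - x + p) -` D" for x
  have T_sets: "T x \<in> sets M" and T_measure: "measure M (T x) = measure M D" for x
    unfolding T_def using haar_measure_translate[OF haar D(1)] by auto
  have T_nonempty: "T x \<noteq> {}" for x
    using T_measure[of x] D by auto
  define packing where "packing E \<longleftrightarrow> finite E \<and> disjoint_family_on T E" for E
  have bound: "real (card E) * measure M D \<le> 1" if "packing E" for E
  proof -
    have "(\<Sum>x\<in>E. measure M (T x)) = measure M (\<Union>x\<in>E. T x)"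
      using that T_sets by (intro finite_measure_finite_Union[symmetric]) (auto simp: packing_def)
    then show ?thesis
      using prob_le_1[of "\<Union>x\<in>E. T x"] by (simp add: T_measure)
  qed
  have "\<exists>E. packing E \<and> (\<forall>E'. packing E' \<longrightarrow> card E' \<le> card E)"
  proof (rule ex_has_greatest_nat)
    show "packing {}"
      by (simp add: packing_def disjoint_family_on_def)
    show "\<forall>E. packing E \<longrightarrow> card E < Suc (nat \<lceil>1 / measure M D\<rceil>)"
    proof (intro allI impI)
      fix E assume "packing E"
      then have "real (card E) \<le> 1 / measure M D"
        using bound D by (auto simp: field_simps)
      then show "card E < Suc (nat \<lceil>1 / measure M D\<rceil>)"
        by linarith
    qed
  qed
  then obtain E where E: "packing E" "\<And>E'. packing E' \<Longrightarrow> card E' \<le> card E"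
    by blast
  have meets: "\<exists>x\<in>E. T x \<inter> T y \<noteq> {}" for y
  proof (rule ccontr)
    assume none: "\<not> (\<exists>x\<in>E. T x \<inter> T y \<noteq> {})"
    then have "y \<notin> E"
      using T_nonempty[of y] by auto
    moreover have "packing (insert y E)"
      using E(1) none by (auto simp: packing_def disjoint_family_on_def)
    ultimately show False
      using E(2)[of "insert y E"] E(1) by (simp add: packing_def)
  qed
  show thesis
  proof (rule that[of E])
    show "finite E"
      using E(1) by (simp add: packing_def)
    show "E \<noteq> {}"
      using meets by blast
    show "real (card E) * measure M D \<le> 1"
      using E(1) by (rule bound)
    show "\<exists>x\<in>E. \<exists>p. - x + p \<in> D \<and> - y + p \<in> D" for y
      using meets[of y] by (auto simp: T_def)
  qed
qed

section \<open>Words and itineraries\<close>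

lemma word_map_append: "word_map f (u @ v) x = word_map f u (word_map f v x)"
  by (induction u) auto

lemma proper_suffixes_Nil: "proper_suffixes [] = {}"
  by (auto simp: mem_proper_suffixes_iff)

lemma proper_suffixes_Cons: "proper_suffixes (i # w) = insert w (proper_suffixes w)"
proof (intro equalityI subsetI)
  fix w' assume "w' \<in> proper_suffixes (i # w)"
  then obtain v where v: "v \<noteq> []" "i # w = v @ w'"
    by (auto simp: mem_proper_suffixes_iff)
  then obtain v' where "w = v' @ w'"
    by (cases v) auto
  then show "w' \<in> insert w (proper_suffixes w)"
    by (cases "v' = []") (auto simp: mem_proper_suffixes_iff)
next
  fix w' assume "w' \<in> insert w (proper_suffixes w)"
  then obtain v where "w = v @ w'"
    by (auto simp: mem_proper_suffixes_iff)
  then have "i # w = (i # v) @ w'"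
    by simp
  then show "w' \<in> proper_suffixes (i # w)"
    unfolding mem_proper_suffixes_iff by blast
qed

lemma finite_proper_suffixes: "finite (proper_suffixes w)"
  by (induction w) (simp_all add: proper_suffixes_Nil proper_suffixes_Cons)

lemma set_proper_suffix: "w' \<in> proper_suffixes w \<Longrightarrow> set w' \<subseteq> set w"
  by (auto simp: mem_proper_suffixes_iff)

lemma finite_words: "finite (words m n)"
  unfolding words_def by (rule finite_subset[OF _ finite_lists_length_eq[of "{..<m}" n]]) auto

lemma card_words: "card (words m n) = m ^ n"
  using card_lists_length_eq[of "{..<m}" n] by (simp add: words_def conj_commute)

lemma sum_words_add:
  fixes h :: "nat list \<Rightarrow> real"
  shows "(\<Sum>w\<in>words m (n + k). h w) = (\<Sum>u\<in>words m n. \<Sum>v\<in>words m k. h (u @ v))"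
proof -
  have "(\<Sum>w\<in>words m (n + k). h w) = (\<Sum>(u, v)\<in>words m n \<times> words m k. h (u @ v))"
  proof (rule sum.reindex_bij_witness[of _ "\<lambda>(u, v). u @ v" "\<lambda>w. (take n w, drop n w)"])
    fix w assume "w \<in> words m (n + k)"
    then show "(take n w, drop n w) \<in> words m n \<times> words m k"
      using set_take_subset[of n w] set_drop_subset[of n w] by (auto simp: words_def)
  qed (auto simp: words_def)
  then show ?thesis
    by (simp add: sum.cartesian_product)
qed

text \<open>
  The labels met along the proper suffixes of \<open>w\<close>.  As a label of \<open>x\<close> the itinerary stands for the
  join, over these suffixes \<open>w'\<close>, of the preimages under \<open>word_map f w'\<close> of the partition given by \<open>X\<close>.
\<close>

primrec itinerary :: "(nat \<Rightarrow> 'a \<Rightarrow> 'a) \<Rightarrow> ('a \<Rightarrow> 'b) \<Rightarrow> nat list \<Rightarrow> 'a \<Rightarrow> 'b list" where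
  "itinerary f X [] x = []"
| "itinerary f X (i # w) x = X (word_map f w x) # itinerary f X w x"

lemma itinerary_append:
  "itinerary f X (u @ v) x = itinerary f X u (word_map f v x) @ itinerary f X v x"
  by (induction u) (auto simp: word_map_append)

lemma itinerary_eq_iff:
  "itinerary f X w x = itinerary f X w y
     \<longleftrightarrow> (\<forall>w'\<in>proper_suffixes w. X (word_map f w' x) = X (word_map f w' y))"
  by (induction w) (auto simp: proper_suffixes_Nil proper_suffixes_Cons)

section \<open>Entropy of itineraries\<close>

locale measure_preserving_family = prob_space M for M :: "'a measure" +
  fixes f :: "nat \<Rightarrow> 'a \<Rightarrow> 'a" and m :: nat
  assumes space_UNIV: "space M = UNIV"
    and m_pos: "m \<ge> 1"
    and measurable_gen: "i < m \<Longrightarrow> f i \<in> measurable M M"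
    and preserves_gen: "i < m \<Longrightarrow> distr M M (f i) = M"
begin

lemma measurable_word_map: "set w \<subseteq> {..<m} \<Longrightarrow> word_map f w \<in> measurable M M"
proof (induction w)
  case Nil
  show ?case
    by (simp add: measurable_ident)
next
  case (Cons i w)
  then have "word_map f w \<in> measurable M M" "f i \<in> measurable M M"
    by (auto simp: measurable_gen)
  then show ?case
    unfolding word_map.simps by (rule measurable_comp)
qed

lemma preserves_word_map: "set w \<subseteq> {..<m} \<Longrightarrow> distr M M (word_map f w) = M"
proof (induction w)
  case Nil
  then show ?case
    by (simp add: id_def distr_id)
next
  case (Cons i w)
  then have i: "i < m" and w: "set w \<subseteq> {..<m}"
    by auto
  have "distr M M (word_map f (i # w)) = distr (distr M M (word_map f w)) M (f i)"
    unfolding word_map.simps by (rule distr_distr[symmetric, OF measurable_gen[OF i] measurable_word_map[OF w]])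
  then show ?case
    unfolding Cons.IH[OF w] preserves_gen[OF i] .
qed

lemma simple_function_itinerary:
  assumes X: "simple_function M X"
  shows "set w \<subseteq> {..<m} \<Longrightarrow> simple_function M (itinerary f X w)"
proof (induction w)
  case (Cons i w)
  then have "simple_function M (\<lambda>x. X (word_map f w x) # itinerary f X w x)"
    by (intro simple_function_compose2[of _ _ _ "(#)"] simple_function_comp[OF measurable_word_map X]) auto
  then show ?case
    by simp
next
  case Nil
  have "itinerary f X [] = (\<lambda>_. [])"
    by auto
  then show ?case
    by simp
qed

text \<open>
  The itinerary along \<open>u @ v\<close> consists of the one along \<open>v\<close> and of the one along \<open>u\<close> read at the
  image point under \<open>v\<close>, and the latter has the entropy of the itinerary along \<open>u\<close> because \<open>v\<close>
  preserves the measure.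
\<close>

lemma shannon_entropy_itinerary_append:
  assumes X: "simple_function M X" and u: "set u \<subseteq> {..<m}" and v: "set v \<subseteq> {..<m}"
  shows "shannon_entropy M (itinerary f X (u @ v))
           \<le> shannon_entropy M (itinerary f X u) + shannon_entropy M (itinerary f X v)"
proof -
  let ?U = "\<lambda>x. itinerary f X u (word_map f v x)" and ?V = "itinerary f X v"
  have U: "simple_function M ?U"
    by (rule simple_function_comp[OF measurable_word_map[OF v] simple_function_itinerary[OF X u]])
  have V: "simple_function M ?V"
    by (rule simple_function_itinerary[OF X v])
  have "shannon_entropy M (itinerary f X (u @ v)) \<le> shannon_entropy M (\<lambda>x. (?U x, ?V x))"
    by (rule shannon_entropy_le_of_determines) (auto simp: itinerary_append U V)
  also have "\<dots> \<le> shannon_entropy M ?U + shannon_entropy M ?V"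
    by (rule shannon_entropy_Pair_le[OF U V])
  also have "shannon_entropy M ?U = shannon_entropy M (itinerary f X u)"
    by (rule shannon_entropy_measure_preserving[OF simple_function_itinerary[OF X u]
          measurable_word_map[OF v] preserves_word_map[OF v]])
  finally show ?thesis .
qed

lemma shannon_entropy_itinerary_le:
  assumes X: "simple_function M X"
  shows "set w \<subseteq> {..<m} \<Longrightarrow> shannon_entropy M (itinerary f X w) \<le> real (length w) * shannon_entropy M X"
proof (induction w)
  case Nil
  have "itinerary f X [] = (\<lambda>_. [])"
    by auto
  then show ?case
    by (simp add: shannon_entropy_def space_UNIV prob_space[unfolded space_UNIV])
next
  case (Cons i w)
  then have i: "i < m" and w: "set w \<subseteq> {..<m}"
    by auto
  have "shannon_entropy M (itinerary f X [i]) \<le> shannon_entropy M X"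
    by (rule shannon_entropy_le_of_determines[OF X]) simp
  then show ?case
    using shannon_entropy_itinerary_append[OF X, of "[i]" w] Cons.IH[OF w] i w
    by (simp add: algebra_simps del: itinerary.simps)
qed

definition mean_entropy :: "('a \<Rightarrow> 'b) \<Rightarrow> nat \<Rightarrow> real" where
  "mean_entropy X n = 1 / real m ^ n * (\<Sum>w\<in>words m n. shannon_entropy M (itinerary f X w))"

lemma mean_entropy_nonneg:
  assumes X: "simple_function M X"
  shows "0 \<le> mean_entropy X n"
  unfolding mean_entropy_def
  by (intro mult_nonneg_nonneg sum_nonneg shannon_entropy_nonneg simple_function_itinerary[OF X])
    (auto simp: words_def)

text \<open>
  Subadditivity along words passes to averages because every word of length \<open>n + k\<close> is uniquely
  \<open>u @ v\<close> with \<open>u\<close> of length \<open>n\<close> and \<open>v\<close> of length \<open>k\<close>.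
\<close>

lemma mean_entropy_subadditive:
  assumes X: "simple_function M X"
  shows "mean_entropy X (n + k) \<le> mean_entropy X n + mean_entropy X k"
proof -
  let ?h = "\<lambda>w. shannon_entropy M (itinerary f X w)"
  have m: "real m > 0"
    using m_pos by simp
  have "(\<Sum>w\<in>words m (n + k). ?h w) = (\<Sum>u\<in>words m n. \<Sum>v\<in>words m k. ?h (u @ v))"
    by (rule sum_words_add)
  also have "\<dots> \<le> (\<Sum>u\<in>words m n. \<Sum>v\<in>words m k. ?h u + ?h v)"
    by (intro sum_mono shannon_entropy_itinerary_append X) (auto simp: words_def)
  also have "\<dots> = real m ^ k * (\<Sum>u\<in>words m n. ?h u) + real m ^ n * (\<Sum>v\<in>words m k. ?h v)"
    by (simp add: sum.distrib card_words flip: sum_distrib_left)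
  finally have "1 / real m ^ (n + k) * (\<Sum>w\<in>words m (n + k). ?h w)
      \<le> 1 / real m ^ (n + k) * (real m ^ k * (\<Sum>u\<in>words m n. ?h u) + real m ^ n * (\<Sum>v\<in>words m k. ?h v))"
    using m by (intro mult_left_mono) auto
  also have "\<dots> = mean_entropy X n + mean_entropy X k"
    using m by (simp add: mean_entropy_def power_add field_simps)
  finally show ?thesis
    by (simp add: mean_entropy_def)
qed

end

section \<open>Existence of the entropy of a partition\<close>

lemma subadditive_mult_add_le:
  fixes b :: "nat \<Rightarrow> real"
  assumes "\<And>n k. b (n + k) \<le> b n + b k"
  shows "b (k * q + r) \<le> real k * b q + b r"
proof (induction k)
  case (Suc k)
  have "b (Suc k * q + r) \<le> b q + b (k * q + r)"
    using assms[of q "k * q + r"] by (simp add: add.assoc)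
  then show ?case
    using Suc.IH by (simp add: algebra_simps)
qed simp

text \<open>
  Fekete's lemma: the limit is the infimum of \<open>b n / n\<close> over \<open>n \<ge> 1\<close>.
\<close>

lemma subadditive_mean_convergent:
  fixes b :: "nat \<Rightarrow> real"
  assumes sub: "\<And>n k. b (n + k) \<le> b n + b k" and nonneg: "\<And>n. 0 \<le> b n"
  shows "convergent (\<lambda>n. b n / real n)"
proof -
  define L where "L = (INF n\<in>{1..}. b n / real n)"
  have bdd: "bdd_below ((\<lambda>n. b n / real n) ` {1..})"
    using nonneg by (intro bdd_belowI[of _ 0]) auto
  have L_le: "L \<le> b n / real n" if "n \<ge> 1" for n
    unfolding L_def using that bdd by (intro cINF_lower) auto
  have "(\<lambda>n. b n / real n) \<longlonglongrightarrow> L"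
  proof (rule LIMSEQ_I)
    fix e :: real
    assume e: "0 < e"
    have "\<exists>q\<ge>1. b q / real q < L + e / 2"
    proof (rule ccontr)
      assume "\<not> ?thesis"
      then have "L + e / 2 \<le> L"
        unfolding L_def by (intro cINF_greatest) (auto simp: not_less L_def)
      then show False
        using e by simp
    qed
    then obtain q where q: "q \<ge> 1" "b q / real q < L + e / 2"
      by blast
    \<comment> \<open>With \<open>n = k * q + r\<close>, \<open>b n / n\<close> exceeds \<open>b q / q\<close> by at most \<open>c / n\<close>.\<close>
    define c where "c = Max (b ` {..<q})"
    have c: "b r \<le> c" if "r < q" for r
      unfolding c_def using that by (intro Max_ge) auto
    have c0: "0 \<le> c"
      using c[of 0] nonneg[of 0] q by simp
    obtain N where N: "c / (e / 2) < real N"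
      using reals_Archimedean2 by blast
    show "\<exists>no. \<forall>n\<ge>no. norm (b n / real n - L) < e"
    proof (intro exI allI impI)
      fix n assume "n \<ge> Suc N"
      then have n: "n \<ge> 1" "real N < real n"
        by auto
      have "b n \<le> real (n div q) * b q + b (n mod q)"
        using subadditive_mult_add_le[of b "n div q" q "n mod q"] sub by simp
      also have "\<dots> \<le> real (n div q) * b q + c"
        using c q by simp
      also have "real (n div q) * b q \<le> real n / real q * b q"
        using nonneg of_nat_div_le_of_nat[of n q, where ?'a = real] by (intro mult_right_mono) auto
      finally have "b n / real n \<le> (real n / real q * b q + c) / real n"
        by (intro divide_right_mono) auto
      also have "\<dots> = b q / real q + c / real n"
        using n q by (simp add: field_simps)
      also have "c / real n < e / 2"
      proof -
        have "c / (e / 2) < real n"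
          using N n(2) by (rule less_trans)
        then show ?thesis
          using n(1) e by (simp add: field_simps)
      qed
      finally have "b n / real n < L + e"
        using q by simp
      then show "norm (b n / real n - L) < e"
        using L_le[OF n(1)] by simp
    qed
  qed
  then show ?thesis
    by (rule convergentI)
qed

definition block_of :: "'a set set \<Rightarrow> 'a \<Rightarrow> 'a set" where
  "block_of \<xi> x = (THE C. C \<in> \<xi> \<and> x \<in> C)"

lemma block_of_eq:
  assumes "disjoint \<xi>" "C \<in> \<xi>" "x \<in> C"
  shows "block_of \<xi> x = C"
  unfolding block_of_def using assms by (intro the_equality) (auto simp: disjoint_def)

lemma block_of_mem:
  assumes "finite_measurable_partition M \<xi>" "x \<in> space M"
  shows "block_of \<xi> x \<in> \<xi>" "x \<in> block_of \<xi> x"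
proof -
  obtain C where "C \<in> \<xi>" "x \<in> C"
    using assms by (auto simp: finite_measurable_partition_def)
  then show "block_of \<xi> x \<in> \<xi>" "x \<in> block_of \<xi> x"
    using block_of_eq[of \<xi> C x] assms by (auto simp: finite_measurable_partition_def)
qed

lemma simple_function_block_of:
  assumes \<xi>: "finite_measurable_partition M \<xi>"
  shows "simple_function M (block_of \<xi>)"
  unfolding simple_function_def
proof (intro conjI ballI)
  show "finite (block_of \<xi> ` space M)"
    using block_of_mem[OF \<xi>] \<xi> by (auto simp: finite_measurable_partition_def intro: finite_subset)
  fix C assume "C \<in> block_of \<xi> ` space M"
  then have C: "C \<in> \<xi>"
    using block_of_mem[OF \<xi>] by auto
  then have "C \<in> sets M"
    using \<xi> by (auto simp: finite_measurable_partition_def)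
  moreover have "block_of \<xi> -` {C} \<inter> space M = C"
    using C \<xi> block_of_mem[OF \<xi>] block_of_eq[of \<xi> C] sets.sets_into_space[OF \<open>C \<in> sets M\<close>]
    by (auto simp: finite_measurable_partition_def)
  ultimately show "block_of \<xi> -` {C} \<inter> space M \<in> sets M"
    by simp
qed

context measure_preserving_family
begin

lemma partition_entropy_join:
  assumes \<xi>: "finite_measurable_partition M \<xi>" and w: "set w \<subseteq> {..<m}"
  shows "partition_entropy M (partition_join (proper_suffixes w) (\<lambda>w'. preimage_partition (word_map f w') \<xi>))
           = shannon_entropy M (itinerary f (block_of \<xi>) w)"
proof (rule partition_entropy_eq_shannon_entropy)
  let ?J = "partition_join (proper_suffixes w) (\<lambda>w'. preimage_partition (word_map f w') \<xi>)"
  have mem: "block_of \<xi> x \<in> \<xi>" "x \<in> block_of \<xi> x" for x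
    using block_of_mem[OF \<xi>] by (auto simp: space_UNIV)
  have dis: "disjoint \<xi>"
    using \<xi> by (simp add: finite_measurable_partition_def)
  show "finite (itinerary f (block_of \<xi>) w ` space M)"
    by (rule simple_functionD(1)[OF simple_function_itinerary[OF simple_function_block_of[OF \<xi>] w]])
  show "\<exists>C\<in>?J. x \<in> C" for x
  proof
    let ?C = "\<lambda>w'. word_map f w' -` block_of \<xi> (word_map f w' x)"
    show "(\<Inter>w'\<in>proper_suffixes w. ?C w') \<in> ?J"
      unfolding partition_join_def preimage_partition_def using mem by blast
    show "x \<in> (\<Inter>w'\<in>proper_suffixes w. ?C w')"
      using mem by auto
  qed
  fix C x
  assume "C \<in> ?J" and x: "x \<in> C"
  then obtain c where c: "\<forall>w'\<in>proper_suffixes w. c w' \<in> (\<lambda>C. word_map f w' -` C) ` \<xi>"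
      and C: "C = (\<Inter>w'\<in>proper_suffixes w. c w')"
    by (auto simp: partition_join_def preimage_partition_def)
  have eq: "y \<in> c w' \<longleftrightarrow> block_of \<xi> (word_map f w' y) = block_of \<xi> (word_map f w' x)"
    if w': "w' \<in> proper_suffixes w" for w' y
  proof -
    obtain B where B: "B \<in> \<xi>" "c w' = word_map f w' -` B"
      using c w' by auto
    have "block_of \<xi> (word_map f w' x) = B"
      using block_of_eq[OF dis B(1)] x w' B(2) C by auto
    moreover have "z \<in> B \<longleftrightarrow> block_of \<xi> z = B" for z
      using block_of_eq[OF dis B(1), of z] mem(2)[of z] by metis
    ultimately show ?thesis
      unfolding B(2) vimage_eq by metis
  qed
  have "y \<in> C \<longleftrightarrow> itinerary f (block_of \<xi>) w y = itinerary f (block_of \<xi>) w x" for y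
    unfolding C itinerary_eq_iff INT_iff using eq by (intro ball_cong refl)
  then show "itinerary f (block_of \<xi>) w -` {itinerary f (block_of \<xi>) w x} \<inter> space M = C"
    unfolding space_UNIV by blast
qed

text \<open>
  The entropy of a partition is defined by \<^const>\<open>lim\<close>, which says nothing unless the limit exists;
  subadditivity provides it.
\<close>

lemma semigroup_entropy_wrt_tendsto:
  assumes \<xi>: "finite_measurable_partition M \<xi>"
  shows "(\<lambda>n. 1 / real n * mean_entropy (block_of \<xi>) n) \<longlonglongrightarrow> semigroup_entropy_wrt M m f \<xi>"
proof -
  have X: "simple_function M (block_of \<xi>)"
    by (rule simple_function_block_of[OF \<xi>])
  have "convergent (\<lambda>n. mean_entropy (block_of \<xi>) n / real n)"
    by (rule subadditive_mean_convergent) (rule mean_entropy_subadditive[OF X] mean_entropy_nonneg[OF X])+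
  then have "(\<lambda>n. 1 / real n * mean_entropy (block_of \<xi>) n) \<longlonglongrightarrow> lim (\<lambda>n. 1 / real n * mean_entropy (block_of \<xi>) n)"
    by (simp add: convergent_LIMSEQ_iff)
  moreover have "semigroup_entropy_wrt M m f \<xi> = lim (\<lambda>n. 1 / real n * mean_entropy (block_of \<xi>) n)"
    unfolding semigroup_entropy_wrt_def mean_entropy_def
    by (intro arg_cong[where f = lim] ext arg_cong2[where f = "(*)"] refl sum.cong partition_entropy_join \<xi>)
      (auto simp: words_def)
  ultimately show ?thesis
    by simp
qed

end

lemma partition_of_label:
  assumes X: "simple_function M X"
  obtains \<xi> where "finite_measurable_partition M \<xi>"
    "\<And>x y. x \<in> space M \<Longrightarrow> y \<in> space M \<Longrightarrow> block_of \<xi> x = block_of \<xi> y \<longleftrightarrow> X x = X y"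
proof
  let ?\<xi> = "(\<lambda>v. X -` {v} \<inter> space M) ` (X ` space M)"
  show "finite_measurable_partition M ?\<xi>"
    using X by (auto simp: finite_measurable_partition_def simple_functionD disjoint_def)
  have "block_of ?\<xi> x = X -` {X x} \<inter> space M" if "x \<in> space M" for x
    using that by (intro block_of_eq) (auto simp: disjoint_def)
  then show "block_of ?\<xi> x = block_of ?\<xi> y \<longleftrightarrow> X x = X y" if "x \<in> space M" "y \<in> space M" for x y
    using that by auto
qed

section \<open>Left-invariant metrics on a compact group\<close>

lemma finite_cover_by_translates:
  fixes U :: "'a::{topological_group_add, metric_space} set"
  assumes cpt: "compact (UNIV :: 'a set)" and U: "open U" "0 \<in> U"
  obtains E where "finite E" "\<And>y. \<exists>x\<in>E. - x + y \<in> U"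
proof -
  have opens: "open ((\<lambda>y. - x + y) -` U)" for x
    by (rule open_vimage[OF U(1)], rule continuous_on_add, rule continuous_on_const, rule continuous_on_id)
  have cover: "UNIV \<subseteq> (\<Union>x\<in>UNIV. (\<lambda>y. - x + y) -` U)"
  proof
    fix y :: 'a
    show "y \<in> (\<Union>x\<in>UNIV. (\<lambda>y. - x + y) -` U)"
      by (rule UN_I[of y]) (use U(2) in simp_all)
  qed
  obtain E where E: "finite E" "UNIV \<subseteq> (\<Union>x\<in>E. (\<lambda>y. - x + y) -` U)"
    by (rule compactE_image[OF cpt opens cover])
  show thesis
  proof (rule that[OF E(1)])
    fix y :: 'a
    have "y \<in> (\<Union>x\<in>E. (\<lambda>y. - x + y) -` U)"
      using E(2) by (rule subsetD) (rule UNIV_I)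
    then show "\<exists>x\<in>E. - x + y \<in> U"
      by simp
  qed
qed

lemma haar_open_neighbourhood_pos:
  fixes M :: "'a::{topological_group_add, metric_space} measure"
  assumes cpt: "compact (UNIV :: 'a set)" and haar: "normalised_haar M" and U: "open U" "0 \<in> U"
  shows "0 < measure M U"
proof -
  obtain E where E: "finite E" "\<And>y. \<exists>x\<in>E. - x + y \<in> U"
    by (rule finite_cover_by_translates[OF cpt U]) (rule that; blast)
  interpret prob_space M
    using haar by (simp add: normalised_haar_def)
  have sp: "space M = UNIV"
    using haar by (auto simp: normalised_haar_def dest: sets_eq_imp_space_eq)
  have T: "(\<lambda>y. - x + y) -` U \<in> sets M" "measure M ((\<lambda>y. - x + y) -` U) = measure M U" for x
    using haar_measure_translate[OF haar, of U] U by auto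
  have "1 = measure M (\<Union>x\<in>E. (\<lambda>y. - x + y) -` U)"
  proof -
    have "(\<Union>x\<in>E. (\<lambda>y. - x + y) -` U) = space M"
      unfolding sp using E(2) by auto
    then show ?thesis
      by (simp add: prob_space)
  qed
  also have "\<dots> \<le> (\<Sum>x\<in>E. measure M ((\<lambda>y. - x + y) -` U))"
    by (rule finite_measure_subadditive_finite) (use E T in auto)
  also have "\<dots> = real (card E) * measure M U"
    by (simp add: T)
  finally show ?thesis
    by (metis measure_nonneg mult_zero_right not_one_le_zero order_le_imp_less_or_eq)
qed

locale left_invariant_metric_group =
  fixes d :: "'a::{topological_group_add, metric_space} \<Rightarrow> 'a \<Rightarrow> real"
  assumes compact_UNIV: "compact (UNIV :: 'a set)"
    and left_invariant: "left_invariant_metric d"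
begin

sublocale Metric_space "UNIV :: 'a set" d
  using left_invariant by (simp add: left_invariant_metric_def)

lemma d_eq: "d x y = d 0 (- x + y)"
proof -
  have "d (- x + x) (- x + y) = d x y"
    using left_invariant unfolding left_invariant_metric_def by blast
  then show ?thesis
    by simp
qed

lemma d_commute: "d x y = d y x"
  by (rule commute)

lemma d_triangle: "d x z \<le> d x y + d y z"
  by (rule triangle) auto

lemma mball_0_eq: "mball 0 \<epsilon> = {y. d 0 y < \<epsilon>}"
  by (auto simp: mball_def)

lemma mtopology_eq: "mtopology = euclidean"
  using left_invariant by (simp add: left_invariant_metric_def)

lemma open_d_ball: "open {y. d 0 y < \<epsilon>}"
  using openin_mball[of 0 \<epsilon>] by (simp only: mtopology_eq mball_0_eq open_openin)

lemma d_ball_in_open: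
  assumes "open U" "0 \<in> U"
  obtains r where "r > 0" "\<And>y. d 0 y < r \<Longrightarrow> y \<in> U"
proof -
  have "openin mtopology U"
    using assms by (simp only: mtopology_eq open_openin)
  then obtain r where "r > 0" "mball 0 r \<subseteq> U"
    using assms unfolding openin_mtopology by blast
  then show thesis
    by (intro that[of r]) (auto simp: mball_0_eq)
qed

text \<open>
  By left invariance \<open>d x y\<close> depends only on \<open>- x + y\<close>.  These differences form a compact set, which
  misses the identity and hence a \<open>d\<close>-ball around it.
\<close>

lemma disjoint_closed_gap:
  assumes K: "closed K" and L: "closed L" and KL: "K \<inter> L = {}"
  obtains r where "r > 0" "\<And>x y. x \<in> K \<Longrightarrow> y \<in> L \<Longrightarrow> r \<le> d x y"
proof -
  let ?S = "(\<lambda>p. - fst p + snd p) ` (K \<times> L)"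
  have "compact K" "compact L"
    using compact_Int_closed[OF compact_UNIV] K L by auto
  moreover have "continuous_on (K \<times> L) (\<lambda>p. - fst p + snd p)"
    by (rule continuous_on_add; (rule continuous_on_minus)?; intro continuous_on_fst continuous_on_snd continuous_on_id)
  ultimately have "compact ?S"
    by (intro compact_continuous_image compact_Times)
  then have "open (- ?S)"
    by (intro open_Compl compact_imp_closed)
  moreover have "- x + y \<noteq> 0" if "x \<in> K" "y \<in> L" for x y
    using that KL by (auto simp flip: eq_neg_iff_add_eq_0)
  then have "0 \<in> - ?S"
    by force
  ultimately obtain r where r: "r > 0" "\<And>y. d 0 y < r \<Longrightarrow> y \<in> - ?S"
    by (rule d_ball_in_open) blast
  show thesis
  proof (rule that[OF r(1)])
    fix x y assume "x \<in> K" "y \<in> L"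
    then have "- x + y \<in> ?S"
      by force
    then show "r \<le> d x y"
      using r(2)[of "- x + y"] d_eq[of x y] by force
  qed
qed

lemma finite_family_gap:
  assumes "finite \<xi>" and "\<And>C. C \<in> \<xi> \<Longrightarrow> closed (K C)"
    and "\<And>C B. C \<in> \<xi> \<Longrightarrow> B \<in> \<xi> \<Longrightarrow> C \<noteq> B \<Longrightarrow> K C \<inter> K B = {}"
  obtains r where "r > 0"
    "\<forall>C\<in>\<xi>. \<forall>B\<in>\<xi>. \<forall>x\<in>K C. \<forall>y\<in>K B. d x y < r \<longrightarrow> C = B"
proof -
  have "\<exists>r>0. C \<noteq> B \<longrightarrow> (\<forall>x\<in>K C. \<forall>y\<in>K B. r \<le> d x y)" if CB: "C \<in> \<xi>" "B \<in> \<xi>" for C B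
  proof (cases "C = B")
    case True
    then show ?thesis
      by (intro exI[of _ 1]) simp
  next
    case False
    obtain r where "r > 0" "\<And>x y. x \<in> K C \<Longrightarrow> y \<in> K B \<Longrightarrow> r \<le> d x y"
      by (rule disjoint_closed_gap[OF assms(2)[OF CB(1)] assms(2)[OF CB(2)] assms(3)[OF CB False]]) blast
    then show ?thesis
      by auto
  qed
  then obtain \<rho> where \<rho>: "\<And>C B. C \<in> \<xi> \<Longrightarrow> B \<in> \<xi> \<Longrightarrow> 0 < \<rho> C B"
      "\<And>C B x y. C \<in> \<xi> \<Longrightarrow> B \<in> \<xi> \<Longrightarrow> C \<noteq> B \<Longrightarrow> x \<in> K C \<Longrightarrow> y \<in> K B \<Longrightarrow> \<rho> C B \<le> d x y"
    by metis
  let ?R = "insert 1 ((\<lambda>(C, B). \<rho> C B) ` (\<xi> \<times> \<xi>))"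
  have fin: "finite ?R"
    using assms(1) by simp
  show thesis
  proof (rule that[of "Min ?R"])
    show "0 < Min ?R"
      using fin \<rho>(1) by (subst Min_gr_iff) auto
    show "\<forall>C\<in>\<xi>. \<forall>B\<in>\<xi>. \<forall>x\<in>K C. \<forall>y\<in>K B. d x y < Min ?R \<longrightarrow> C = B"
    proof (intro ballI impI)
      fix C B x y
      assume *: "C \<in> \<xi>" "B \<in> \<xi>" "x \<in> K C" "y \<in> K B" "d x y < Min ?R"
      then have "Min ?R \<le> \<rho> C B"
        using fin by (intro Min_le) auto
      then show "C = B"
        using \<rho>(2)[of C B x y] * by force
    qed
  qed
qed

text \<open>
  The key to the upper bound.  Each block \<open>C\<close> contains a closed set \<open>K C\<close> of nearly the same measure,
  and the \<open>K C\<close> lie at a positive mutual distance.  The auxiliary label \<open>R\<close> is \<open>None\<close> on the union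
  \<open>Y\<close> of the \<open>K C\<close> and names the block elsewhere.  It has little entropy, since \<open>Y\<close> has nearly full
  measure, yet together with a rough knowledge of the position it determines the block: either it
  names the block, or two nearby points lie in the same \<open>K C\<close>.
\<close>

lemma robust_coding:
  assumes haar: "normalised_haar M" and \<xi>: "finite_measurable_partition M \<xi>" and \<kappa>: "\<kappa> > 0"
  obtains R :: "'a \<Rightarrow> 'a set option" and r where
    "simple_function M R" "shannon_entropy M R \<le> \<kappa>" "r > 0"
    "\<forall>x y. R x = R y \<longrightarrow> d x y < r \<longrightarrow> block_of \<xi> x = block_of \<xi> y"
proof -
  interpret prob_space M
    using haar by (simp add: normalised_haar_def)
  have M: "sets M = sets borel"
    using haar by (simp add: normalised_haar_def)
  then have sp: "space M = UNIV"
    by (auto dest: sets_eq_imp_space_eq)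
  have \<xi>': "finite \<xi>" "\<And>C. C \<in> \<xi> \<Longrightarrow> C \<in> sets M" "disjoint \<xi>"
    using \<xi> by (auto simp: finite_measurable_partition_def)
  have block: "block_of \<xi> x \<in> \<xi>" "x \<in> block_of \<xi> x" for x
    using block_of_mem[OF \<xi>] by (auto simp: sp)
  obtain \<delta> where \<delta>: "\<delta> > 0"
    "\<And>X :: 'a \<Rightarrow> 'a set option. simple_function M X \<Longrightarrow> card (X ` space M) \<le> card \<xi> + 1
       \<Longrightarrow> measure M {x \<in> space M. X x \<noteq> None} < \<delta> \<Longrightarrow> shannon_entropy M X \<le> \<kappa>"
    by (rule shannon_entropy_nearly_constant[OF \<kappa>]) (rule that; blast)
  have "\<exists>K. closed K \<and> K \<subseteq> C \<and> measure M (C - K) < \<delta> / (real (card \<xi>) + 1)" if C: "C \<in> \<xi>" for C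
  proof -
    obtain F U where FU: "closed F" "open U" "F \<subseteq> C" "C \<subseteq> U" "measure M (U - F) < \<delta> / (real (card \<xi>) + 1)"
      using borel_approximation_closed_open[OF finite_measure_axioms M, of C "\<delta> / (real (card \<xi>) + 1)"]
        \<xi>'(2)[OF C] \<delta>(1) M by auto
    have "measure M (C - F) \<le> measure M (U - F)"
      by (rule finite_measure_mono) (use FU M in auto)
    then show ?thesis
      using FU by (intro exI[of _ F]) auto
  qed
  then obtain K where K: "\<And>C. C \<in> \<xi> \<Longrightarrow> closed (K C)" "\<And>C. C \<in> \<xi> \<Longrightarrow> K C \<subseteq> C"
      "\<And>C. C \<in> \<xi> \<Longrightarrow> measure M (C - K C) < \<delta> / (real (card \<xi>) + 1)"
    by metis
  have disj: "K C \<inter> K B = {}" if "C \<in> \<xi>" "B \<in> \<xi>" "C \<noteq> B" for C B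
  proof -
    have "C \<inter> B = {}"
      using \<xi>'(3) that by (rule disjointD)
    then show ?thesis
      using K(2)[OF that(1)] K(2)[OF that(2)] by blast
  qed
  obtain r where r: "r > 0"
    "\<forall>C\<in>\<xi>. \<forall>B\<in>\<xi>. \<forall>x\<in>K C. \<forall>y\<in>K B. d x y < r \<longrightarrow> C = B"
    by (rule finite_family_gap[of \<xi> K, OF \<xi>'(1) K(1) disj])
  define Y where "Y = (\<Union>C\<in>\<xi>. K C)"
  have K_sets: "K C \<in> sets M" if "C \<in> \<xi>" for C
    using K(1)[OF that] M by auto
  then have Y: "Y \<in> sets M"
    unfolding Y_def using \<xi>'(1) by (intro sets.finite_UN) auto
  define R where "R x = (if x \<in> Y then None else Some (block_of \<xi> x))" for x
  show thesis
  proof (rule that[OF _ _ r(1)])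
    show R: "simple_function M R"
      unfolding R_def
      by (rule simple_function_If_set) (use Y in \<open>auto intro: simple_function_compose1[OF simple_function_block_of[OF \<xi>]]\<close>)
    show "shannon_entropy M R \<le> \<kappa>"
    proof (rule \<delta>(2)[OF R])
      have "R ` space M \<subseteq> insert None (Some ` \<xi>)"
        using block by (auto simp: R_def)
      then have "card (R ` space M) \<le> card (insert None (Some ` \<xi>))"
        using \<xi>'(1) by (intro card_mono) auto
      also have "\<dots> \<le> card \<xi> + 1"
        using \<xi>'(1) card_insert_le_m1[of "card \<xi> + 1" "Some ` \<xi>" None] card_image_le[OF \<xi>'(1), of Some] by simp
      finally show "card (R ` space M) \<le> card \<xi> + 1" .
      have "{x \<in> space M. R x \<noteq> None} \<subseteq> (\<Union>C\<in>\<xi>. C - K C)"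
      proof
        fix x assume "x \<in> {x \<in> space M. R x \<noteq> None}"
        then have "x \<notin> Y"
          by (auto simp: R_def)
        then have "x \<notin> K (block_of \<xi> x)"
          using block by (auto simp: Y_def)
        then show "x \<in> (\<Union>C\<in>\<xi>. C - K C)"
          using block by blast
      qed
      then have "measure M {x \<in> space M. R x \<noteq> None} \<le> measure M (\<Union>C\<in>\<xi>. C - K C)"
        by (rule finite_measure_mono) (use \<xi>' K_sets in \<open>auto intro!: sets.finite_UN\<close>)
      also have "\<dots> \<le> (\<Sum>C\<in>\<xi>. measure M (C - K C))"
        by (rule finite_measure_subadditive_finite) (use \<xi>' K_sets in auto)
      also have "\<dots> \<le> (\<Sum>C\<in>\<xi>. \<delta> / (real (card \<xi>) + 1))"
        using K(3) by (intro sum_mono less_imp_le)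
      also have "\<dots> < \<delta>"
        using \<delta>(1) by (simp add: field_simps)
      finally show "measure M {x \<in> space M. R x \<noteq> None} < \<delta>" .
    qed
    show "\<forall>x y. R x = R y \<longrightarrow> d x y < r \<longrightarrow> block_of \<xi> x = block_of \<xi> y"
    proof (intro allI impI)
      fix x y
      assume Rxy: "R x = R y" and dxy: "d x y < r"
      show "block_of \<xi> x = block_of \<xi> y"
      proof (cases "x \<in> Y")
        case True
        then have "y \<in> Y"
          using Rxy by (auto simp: R_def split: if_splits)
        then obtain C B where "C \<in> \<xi>" "x \<in> K C" "B \<in> \<xi>" "y \<in> K B"
          using True by (auto simp: Y_def)
        moreover from this have "C = B"
          using r(2) dxy by blast
        ultimately show ?thesis
          using K(2) block_of_eq[OF \<xi>'(3)] by (metis subsetD)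
      next
        case False
        then show ?thesis
          using Rxy by (auto simp: R_def split: if_splits)
      qed
    qed
  qed
qed

lemma fine_label:
  assumes M: "sets M = sets borel" and \<epsilon>: "\<epsilon> > 0"
  obtains X :: "'a \<Rightarrow> 'a" where "simple_function M X" "\<And>x y. X x = X y \<Longrightarrow> d x y < \<epsilon>"
proof -
  let ?U = "{y. d 0 y < \<epsilon> / 2}"
  obtain E where E: "finite E" "\<And>y. \<exists>x\<in>E. - x + y \<in> ?U"
    by (rule finite_cover_by_translates[OF compact_UNIV open_d_ball, of "\<epsilon> / 2"]) (use \<epsilon> in simp, blast)
  have "(\<lambda>y. - x + y) -` ?U \<in> sets M" for x
  proof -
    have "open ((\<lambda>y. - x + y) -` ?U)"
      by (rule open_vimage[OF open_d_ball], rule continuous_on_add, rule continuous_on_const, rule continuous_on_id)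
    then show ?thesis
      using M by simp
  qed
  from finite_cover_selector[of E "\<lambda>x. (\<lambda>y. - x + y) -` ?U", OF E(1) this] obtain X where X: "simple_function M X"
      "\<forall>x\<in>\<Union>e\<in>E. (\<lambda>y. - e + y) -` ?U. X x \<in> E \<and> x \<in> (\<lambda>y. - X x + y) -` ?U"
    by (elim exE conjE) (rule that)
  have near: "d (X x) x < \<epsilon> / 2" for x
    using X(2) E(2)[of x] d_eq[of "X x" x] by auto
  show thesis
  proof (rule that[OF X(1)])
    fix x y assume "X x = X y"
    then show "d x y < \<epsilon>"
      using near[of x] near[of y] d_triangle[of x y "X x"] d_commute[of x "X x"] by simp
  qed
qed

end

section \<open>Affine maps\<close>

locale affine_action = left_invariant_metric_group d
  for d :: "'a::{topological_group_add, metric_space} \<Rightarrow> 'a \<Rightarrow> real" +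
  fixes A :: "nat \<Rightarrow> 'a \<Rightarrow> 'a" and a :: "nat \<Rightarrow> 'a" and g :: "nat \<Rightarrow> 'a \<Rightarrow> 'a"
    and m :: nat and M :: "'a measure"
  assumes m_ge_1: "m \<ge> 1"
    and endo: "i < m \<Longrightarrow> group_endomorphism (A i)"
    and surj: "i < m \<Longrightarrow> surj (A i)"
    and haar: "normalised_haar M"
    and affine: "i < m \<Longrightarrow> g i x = a i + A i x"
begin

lemma sets_M: "sets M = sets borel"
  using haar by (simp add: normalised_haar_def)

sublocale prob_space M
  using haar by (simp add: normalised_haar_def)

lemma space_M: "space M = UNIV"
  using sets_M by (auto dest: sets_eq_imp_space_eq)

lemma A_measurable: "i < m \<Longrightarrow> A i \<in> measurable M M"
  using endo[of i] by (simp add: measurable_cong_sets[OF sets_M sets_M] group_endomorphism_def borel_measurable_continuous_onI)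

sublocale measure_preserving_family M g m
proof
  show "space M = UNIV" "m \<ge> 1"
    by (rule space_M m_ge_1)+
  fix i assume i: "i < m"
  have g: "g i = (\<lambda>x. a i + x) \<circ> A i"
    using affine[OF i] by auto
  have t: "(\<lambda>x. a i + x) \<in> measurable M M"
    by (simp add: measurable_cong_sets[OF sets_M sets_M] borel_measurable_translation)
  show "g i \<in> measurable M M"
    unfolding g by (rule measurable_comp[OF A_measurable[OF i] t])
  have "distr M M (g i) = distr (distr M M (A i)) M (\<lambda>x. a i + x)"
    unfolding g by (rule distr_distr[symmetric, OF t A_measurable[OF i]])
  also have "distr M M (A i) = M"
    by (rule surjective_endomorphism_preserves_haar[OF compact_UNIV haar endo[OF i] surj[OF i]])
  also have "distr M M (\<lambda>x. a i + x) = M"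
    using haar by (simp add: normalised_haar_def)
  finally show "distr M M (g i) = M" .
qed

lemma word_map_A_add: "set w \<subseteq> {..<m} \<Longrightarrow> word_map A w (x + y) = word_map A w x + word_map A w y"
  using endo by (induction w) (auto simp: group_endomorphism_def)

lemma word_map_A_continuous: "set w \<subseteq> {..<m} \<Longrightarrow> continuous_on UNIV (word_map A w)"
proof (induction w)
  case (Cons i w)
  then have "continuous_on UNIV (A i \<circ> word_map A w)"
    using endo[of i] by (intro continuous_on_compose) (auto simp: group_endomorphism_def intro: continuous_on_subset)
  then show ?case
    by simp
qed (simp add: id_def)

lemma word_map_A_0: "set w \<subseteq> {..<m} \<Longrightarrow> word_map A w 0 = 0"
  using word_map_A_add[of w 0 0] by (metis add.right_neutral add_left_imp_eq)

lemma word_map_A_minus: "set w \<subseteq> {..<m} \<Longrightarrow> word_map A w (- x) = - word_map A w x"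
  using word_map_A_add[of w "- x" x] word_map_A_0[of w] by (simp add: eq_neg_iff_add_eq_0)

text \<open>
  Words in the affine maps differ from words in the endomorphisms only by a left translation, which
  a left-invariant metric does not see.
\<close>

lemma word_map_affine: "set w \<subseteq> {..<m} \<Longrightarrow> word_map g w x = word_map g w 0 + word_map A w x"
proof (induction w)
  case (Cons i w)
  then have i: "i < m" and w: "set w \<subseteq> {..<m}"
    by auto
  have add: "A i (y + z) = A i y + A i z" for y z
    using endo[OF i] by (simp add: group_endomorphism_def)
  show ?case
    using Cons.IH[OF w] by (simp add: affine[OF i] add add.assoc)
qed simp

lemma d_word_map_A:
  assumes w: "set w \<subseteq> {..<m}"
  shows "d (word_map A w x) (word_map A w y) = d 0 (word_map A w (- x + y))"
  using d_eq[of "word_map A w x" "word_map A w y"] by (simp add: word_map_A_add[OF w] word_map_A_minus[OF w])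

lemma d_word_map_g:
  assumes w: "set w \<subseteq> {..<m}"
  shows "d (word_map g w x) (word_map g w y) = d (word_map A w x) (word_map A w y)"
proof -
  have "d (word_map g w x) (word_map g w y)
      = d (word_map g w 0 + word_map A w x) (word_map g w 0 + word_map A w y)"
    using word_map_affine[OF w, of x] word_map_affine[OF w, of y] by simp
  also have "\<dots> = d (word_map A w x) (word_map A w y)"
    using left_invariant by (simp add: left_invariant_metric_def)
  finally show ?thesis .
qed

lemma D_set_eq: "D_set d w \<epsilon> A = {p. \<forall>w'\<in>proper_suffixes w. d 0 (word_map A w' p) < \<epsilon>}"
  unfolding D_set_def mball_0_eq by auto

text \<open>
  The translate of \<^const>\<open>D_set\<close> by \<open>x\<close> is the Bowen ball around \<open>x\<close> along the word \<open>w\<close>, so all Bowen balls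
  of one radius along \<open>w\<close> have the same Haar measure.
\<close>

lemma translate_mem_D_set:
  assumes w: "set w \<subseteq> {..<m}"
  shows "- x + y \<in> D_set d w \<epsilon> A
     \<longleftrightarrow> (\<forall>w'\<in>proper_suffixes w. d (word_map A w' x) (word_map A w' y) < \<epsilon>)"
proof -
  have "d (word_map A w' x) (word_map A w' y) = d 0 (word_map A w' (- x + y))" if "w' \<in> proper_suffixes w" for w'
    using set_proper_suffix[OF that] w by (intro d_word_map_A) auto
  then show ?thesis
    by (simp add: D_set_eq)
qed

lemma D_set_open:
  assumes w: "set w \<subseteq> {..<m}"
  shows "open (D_set d w \<epsilon> A)"
proof -
  have "open (word_map A w' -` mball 0 \<epsilon>)" if "w' \<in> proper_suffixes w" for w'
    using set_proper_suffix[OF that] w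
    by (intro open_vimage word_map_A_continuous) (auto simp: mball_0_eq open_d_ball)
  then show ?thesis
    unfolding D_set_def by (intro open_INT finite_proper_suffixes) auto
qed

lemma D_set_sets: "set w \<subseteq> {..<m} \<Longrightarrow> D_set d w \<epsilon> A \<in> sets borel"
  by (intro borel_open D_set_open)

lemma D_set_pos:
  assumes w: "set w \<subseteq> {..<m}" and \<epsilon>: "\<epsilon> > 0"
  shows "0 < measure M (D_set d w \<epsilon> A)"
proof (rule haar_open_neighbourhood_pos[OF compact_UNIV haar D_set_open[OF w]])
  have "word_map A w' 0 = 0" if "w' \<in> proper_suffixes w" for w'
    using set_proper_suffix[OF that] w by (intro word_map_A_0) auto
  then show "0 \<in> D_set d w \<epsilon> A"
    using \<epsilon> by (simp add: D_set_eq)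
qed

lemma D_set_mono: "\<epsilon> \<le> \<epsilon>' \<Longrightarrow> D_set d w \<epsilon> A \<subseteq> D_set d w \<epsilon>' A"
  by (force simp: D_set_eq)

lemma inverse_D_set_antimono:
  assumes w: "set w \<subseteq> {..<m}" and \<epsilon>: "0 < \<epsilon>" "\<epsilon> \<le> \<epsilon>'"
  shows "1 / measure M (D_set d w \<epsilon>' A) \<le> 1 / measure M (D_set d w \<epsilon> A)"
proof (rule divide_left_mono)
  show "measure M (D_set d w \<epsilon> A) \<le> measure M (D_set d w \<epsilon>' A)"
    using D_set_mono[OF \<epsilon>(2)] D_set_sets[OF w] sets_M by (intro finite_measure_mono) auto
  show "0 < measure M (D_set d w \<epsilon>' A) * measure M (D_set d w \<epsilon> A)"
    using \<epsilon> by (intro mult_pos_pos D_set_pos[OF w]) auto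
qed simp

text \<open>
  If the blocks have diameter less than \<open>\<epsilon>\<close>, points with equal itineraries lie in a common Bowen ball,
  so no level set of the itinerary has more measure than \<^const>\<open>D_set\<close>.
\<close>

lemma shannon_entropy_itinerary_ge:
  assumes X: "simple_function M X" and fine: "\<And>x y. X x = X y \<Longrightarrow> d x y < \<epsilon>"
    and w: "set w \<subseteq> {..<m}"
  shows "ln (1 / measure M (D_set d w \<epsilon> A)) \<le> shannon_entropy M (itinerary g X w)"
proof (rule shannon_entropy_ge_of_level_sets_le[OF simple_function_itinerary[OF X w]])
  fix x
  let ?level = "itinerary g X w -` {itinerary g X w x} \<inter> space M"
  have "?level \<subseteq> (\<lambda>p. - x + p) -` D_set d w \<epsilon> A"
  proof
    fix y assume "y \<in> ?level"
    then have "\<forall>w'\<in>proper_suffixes w. X (word_map g w' x) = X (word_map g w' y)"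
      by (simp flip: itinerary_eq_iff)
    then have "\<forall>w'\<in>proper_suffixes w. d (word_map g w' x) (word_map g w' y) < \<epsilon>"
      using fine by blast
    moreover have "d (word_map g w' x) (word_map g w' y) = d (word_map A w' x) (word_map A w' y)"
      if "w' \<in> proper_suffixes w" for w'
      using set_proper_suffix[OF that] w by (intro d_word_map_g) auto
    ultimately show "y \<in> (\<lambda>p. - x + p) -` D_set d w \<epsilon> A"
      by (simp add: translate_mem_D_set[OF w])
  qed
  then show "measure M ?level \<le> measure M (D_set d w \<epsilon> A)"
    using finite_measure_mono[of ?level "(\<lambda>p. - x + p) -` D_set d w \<epsilon> A"]
      haar_measure_translate[OF haar D_set_sets[OF w], of "- x"] by simp
qed

text \<open>
  Let \<open>R\<close> and \<open>r\<close> be as in \<open>robust_coding\<close>.  At most \<open>1 / measure M (D_set d w (r / 4) A)\<close> Bowen balls of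
  radius \<open>r / 2\<close> cover the group.  The ball containing a point locates its orbit along \<open>w\<close> up to \<open>r\<close>,
  and the \<open>R\<close>-itinerary supplies what is missing to know the \<open>\<xi>\<close>-itinerary, at a cost of at most
  \<open>\<kappa>\<close> per letter.
\<close>

lemma shannon_entropy_itinerary_block_le:
  assumes \<xi>: "finite_measurable_partition M \<xi>" and \<kappa>: "\<kappa> > 0"
  obtains r where "r > 0"
    "\<And>w. set w \<subseteq> {..<m} \<Longrightarrow> shannon_entropy M (itinerary g (block_of \<xi>) w)
        \<le> ln (1 / measure M (D_set d w r A)) + real (length w) * \<kappa>"
proof -
  obtain R :: "'a \<Rightarrow> 'a set option" and r where R: "simple_function M R" "shannon_entropy M R \<le> \<kappa>" "r > 0"
    "\<forall>x y. R x = R y \<longrightarrow> d x y < r \<longrightarrow> block_of \<xi> x = block_of \<xi> y"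
    by (rule robust_coding[OF haar \<xi> \<kappa>])
  \<comment> \<open>Meeting balls of radius \<open>r / 4\<close> have centres closer than \<open>r / 2\<close>, and two points closer than
    \<open>r / 2\<close> to one centre are closer than \<open>r\<close> to each other.\<close>
  show thesis
  proof (rule that[of "r / 4"])
    show "0 < r / 4"
      using R by simp
    fix w assume w: "set w \<subseteq> {..<m}"
    let ?D = "D_set d w (r / 4) A"
    have pos: "0 < measure M ?D"
      using R by (intro D_set_pos[OF w]) auto
    obtain E where E: "finite E" "E \<noteq> {}" "real (card E) * measure M ?D \<le> 1"
      "\<And>y. \<exists>x\<in>E. \<exists>p. - x + p \<in> ?D \<and> - y + p \<in> ?D"
      using haar_packing[OF haar D_set_sets[OF w] pos] by metis
    let ?V = "\<lambda>e. (\<lambda>y. - e + y) -` D_set d w (r / 2) A"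
    have "?V e \<in> sets M" for e
      by (rule haar_measure_translate(1)[OF haar D_set_sets[OF w]])
    from finite_cover_selector[of E ?V, OF E(1) this] obtain lab
      where lab: "simple_function M lab" "\<forall>x\<in>\<Union>e\<in>E. ?V e. lab x \<in> E \<and> x \<in> ?V (lab x)"
      by (elim exE conjE) (rule that)
    have cover: "y \<in> (\<Union>e\<in>E. ?V e)" for y
    proof -
      obtain e p where ep: "e \<in> E" "- e + p \<in> ?D" "- y + p \<in> ?D"
        using E(4)[of y] by blast
      have "d (word_map A w' e) (word_map A w' y) < r / 2" if w': "w' \<in> proper_suffixes w" for w'
      proof -
        have "d (word_map A w' e) (word_map A w' p) < r / 4" "d (word_map A w' y) (word_map A w' p) < r / 4"
          using ep w' by (auto simp: translate_mem_D_set[OF w])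
        then show ?thesis
          using d_triangle[of "word_map A w' e" "word_map A w' y" "word_map A w' p"]
            d_commute[of "word_map A w' y" "word_map A w' p"] by simp
      qed
      then have "- e + y \<in> D_set d w (r / 2) A"
        by (simp add: translate_mem_D_set[OF w])
      then show ?thesis
        using ep(1) by blast
    qed
    have close: "d (word_map g w' x) (word_map g w' y) < r"
      if "lab x = lab y" and w': "w' \<in> proper_suffixes w" for x y w'
    proof -
      have near: "d (word_map A w' (lab z)) (word_map A w' z) < r / 2" for z
      proof -
        have "- lab z + z \<in> D_set d w (r / 2) A"
          using lab(2) cover[of z] by blast
        then show ?thesis
          using w' by (simp add: translate_mem_D_set[OF w])
      qed
      have "d (word_map A w' x) (word_map A w' y) < r"
        using near[of x] near[of y] that(1)
          d_triangle[of "word_map A w' x" "word_map A w' y" "word_map A w' (lab x)"]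
          d_commute[of "word_map A w' x" "word_map A w' (lab x)"] by simp
      moreover have "d (word_map g w' x) (word_map g w' y) = d (word_map A w' x) (word_map A w' y)"
        using set_proper_suffix[OF w'] w by (intro d_word_map_g) auto
      ultimately show ?thesis
        by simp
    qed
    have itR: "simple_function M (itinerary g R w)"
      by (rule simple_function_itinerary[OF R(1) w])
    have "shannon_entropy M (itinerary g (block_of \<xi>) w) \<le> shannon_entropy M (\<lambda>x. (lab x, itinerary g R w x))"
    proof (rule shannon_entropy_le_of_determines[OF simple_function_Pair[OF lab(1) itR]])
      fix x y
      assume "(lab x, itinerary g R w x) = (lab y, itinerary g R w y)"
      then have "lab x = lab y" "\<forall>w'\<in>proper_suffixes w. R (word_map g w' x) = R (word_map g w' y)"
        by (auto simp: itinerary_eq_iff)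
      then show "itinerary g (block_of \<xi>) w x = itinerary g (block_of \<xi>) w y"
        using R(4) close unfolding itinerary_eq_iff by blast
    qed
    also have "\<dots> \<le> shannon_entropy M lab + shannon_entropy M (itinerary g R w)"
      by (rule shannon_entropy_Pair_le[OF lab(1) itR])
    also have "shannon_entropy M (itinerary g R w) \<le> real (length w) * shannon_entropy M R"
      by (rule shannon_entropy_itinerary_le[OF R(1) w])
    also have "\<dots> \<le> real (length w) * \<kappa>"
      using R(2) by (intro mult_left_mono) auto
    also have "shannon_entropy M lab \<le> ln (1 / measure M ?D)"
    proof -
      have "lab ` space M \<subseteq> E"
        using lab(2) cover by blast
      then have "card (lab ` space M) \<le> card E"
        using E(1) by (intro card_mono)
      also have "real (card E) \<le> 1 / measure M ?D"
        using E(3) pos by (simp add: field_simps)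
      finally have "real (card (lab ` space M)) \<le> 1 / measure M ?D"
        by simp
      moreover have "0 < card (lab ` space M)"
        using simple_functionD(1)[OF lab(1)] by (simp add: card_gt_0_iff space_M)
      ultimately have "ln (card (lab ` space M)) \<le> ln (1 / measure M ?D)"
        by (intro ln_mono) auto
      then show ?thesis
        using shannon_entropy_le_ln_card[OF lab(1)] by simp
    qed
    finally show "shannon_entropy M (itinerary g (block_of \<xi>) w)
        \<le> ln (1 / measure M ?D) + real (length w) * \<kappa>"
      by simp
  qed
qed

end

section \<open>The two growth rates and the entropy\<close>

lemma tendsto_at_right_0_of_antimono:
  fixes F :: "real \<Rightarrow> ereal"
  assumes anti: "\<And>\<epsilon> \<epsilon>'. 0 < \<epsilon> \<Longrightarrow> \<epsilon> \<le> \<epsilon>' \<Longrightarrow> F \<epsilon>' \<le> F \<epsilon>"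
  shows "(F \<longlongrightarrow> (SUP \<epsilon>\<in>{0<..}. F \<epsilon>)) (at_right 0)"
proof (rule order_tendstoI)
  fix y assume "y < (SUP \<epsilon>\<in>{0<..}. F \<epsilon>)"
  then obtain \<epsilon>0 where \<epsilon>0: "0 < \<epsilon>0" "y < F \<epsilon>0"
    by (auto simp: less_SUP_iff)
  show "\<forall>\<^sub>F \<epsilon> in at_right 0. y < F \<epsilon>"
    unfolding eventually_at_right_field
  proof (intro exI conjI allI impI)
    show "0 < \<epsilon>0"
      by (rule \<epsilon>0)
    fix \<epsilon> assume "0 < \<epsilon>" "\<epsilon> < \<epsilon>0"
    then show "y < F \<epsilon>"
      using anti[of \<epsilon> \<epsilon>0] \<epsilon>0 by (meson less_le_trans less_imp_le)
  qed
next
  fix y assume y: "(SUP \<epsilon>\<in>{0<..}. F \<epsilon>) < y"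
  have "F \<epsilon> < y" if "0 < \<epsilon>" for \<epsilon>
    using y that by (intro le_less_trans[OF SUP_upper y]) auto
  then show "\<forall>\<^sub>F \<epsilon> in at_right 0. F \<epsilon> < y"
    by (auto simp: eventually_at_right_field intro: exI[of _ 1])
qed

text \<open>
  Concavity of the logarithm, from its tangent line at the mean \<open>c\<close>.
\<close>

lemma mean_ln_le_ln_mean:
  fixes y :: "'b \<Rightarrow> real"
  assumes "finite S" "S \<noteq> {}" and pos: "\<And>s. s \<in> S \<Longrightarrow> 0 < y s"
  shows "1 / real (card S) * (\<Sum>s\<in>S. ln (y s)) \<le> ln (1 / real (card S) * (\<Sum>s\<in>S. y s))"
proof -
  have card: "0 < real (card S)"
    using assms by (simp add: card_gt_0_iff)
  define c where "c = 1 / real (card S) * (\<Sum>s\<in>S. y s)"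
  have c: "0 < c"
    unfolding c_def using assms card by (intro mult_pos_pos sum_pos) auto
  have "ln (y s) \<le> y s / c - 1 + ln c" if "s \<in> S" for s
    using ln_le_minus_one[of "y s / c"] pos[OF that] c by (simp add: ln_div)
  then have "(\<Sum>s\<in>S. ln (y s)) \<le> (\<Sum>s\<in>S. y s / c - 1 + ln c)"
    by (rule sum_mono)
  also have "\<dots> = (\<Sum>s\<in>S. y s) / c - real (card S) + real (card S) * ln c"
    by (simp add: sum.distrib sum_subtractf sum_divide_distrib)
  also have "(\<Sum>s\<in>S. y s) = c * real (card S)"
    using card by (simp add: c_def)
  finally have "(\<Sum>s\<in>S. ln (y s)) \<le> real (card S) * ln c"
    using c by simp
  then show ?thesis
    using card unfolding c_def[symmetric] by (simp add: field_simps)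
qed

context affine_action
begin

lemma set_words: "w \<in> words m n \<Longrightarrow> set w \<subseteq> {..<m}"
  by (simp add: words_def)

lemma lower_rate_antimono:
  assumes \<epsilon>: "0 < \<epsilon>" "\<epsilon> \<le> \<epsilon>'"
  shows "lower_rate d M m A \<epsilon>' \<le> lower_rate d M m A \<epsilon>"
  unfolding lower_rate_def
proof (intro Limsup_mono always_eventually allI)
  fix n
  have "ln (1 / measure M (D_set d w \<epsilon>' A)) \<le> ln (1 / measure M (D_set d w \<epsilon> A))" if "w \<in> words m n" for w
    using inverse_D_set_antimono[OF set_words[OF that] \<epsilon>] D_set_pos[OF set_words[OF that], of \<epsilon>'] \<epsilon>
    by (intro ln_mono) auto
  then show "ereal (1 / real n * (1 / real m ^ n * (\<Sum>w\<in>words m n. ln (1 / measure M (D_set d w \<epsilon>' A)))))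
      \<le> ereal (1 / real n * (1 / real m ^ n * (\<Sum>w\<in>words m n. ln (1 / measure M (D_set d w \<epsilon> A)))))"
    by (intro iffD2[OF ereal_less_eq(3)] mult_left_mono sum_mono) auto
qed

lemma upper_rate_antimono:
  assumes \<epsilon>: "0 < \<epsilon>" "\<epsilon> \<le> \<epsilon>'"
  shows "upper_rate d M m A \<epsilon>' \<le> upper_rate d M m A \<epsilon>"
  unfolding upper_rate_def
proof (intro Limsup_mono always_eventually allI)
  fix n
  have "words m n \<noteq> {}"
    using card_words[of m n] m_ge_1 by (metis card.empty not_one_le_zero power_eq_0_iff)
  moreover have "0 < 1 / measure M (D_set d w \<epsilon>' A)" if "w \<in> words m n" for w
    using D_set_pos[OF set_words[OF that], of \<epsilon>'] \<epsilon> by simp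
  ultimately have "0 < (\<Sum>w\<in>words m n. 1 / measure M (D_set d w \<epsilon>' A))"
    by (intro sum_pos finite_words)
  then have "0 < 1 / real m ^ n * (\<Sum>w\<in>words m n. 1 / measure M (D_set d w \<epsilon>' A))"
    using m_ge_1 by (intro mult_pos_pos) auto
  moreover have "1 / real m ^ n * (\<Sum>w\<in>words m n. 1 / measure M (D_set d w \<epsilon>' A))
      \<le> 1 / real m ^ n * (\<Sum>w\<in>words m n. 1 / measure M (D_set d w \<epsilon> A))"
    by (intro mult_left_mono sum_mono inverse_D_set_antimono[OF set_words \<epsilon>]) auto
  ultimately have "ln (1 / real m ^ n * (\<Sum>w\<in>words m n. 1 / measure M (D_set d w \<epsilon>' A)))
      \<le> ln (1 / real m ^ n * (\<Sum>w\<in>words m n. 1 / measure M (D_set d w \<epsilon> A)))"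
    by (intro ln_mono) auto
  then show "ereal (1 / real n * ln (1 / real m ^ n * (\<Sum>w\<in>words m n. 1 / measure M (D_set d w \<epsilon>' A))))
      \<le> ereal (1 / real n * ln (1 / real m ^ n * (\<Sum>w\<in>words m n. 1 / measure M (D_set d w \<epsilon> A))))"
    by (intro iffD2[OF ereal_less_eq(3)] mult_left_mono) auto
qed

lemma lower_rate_le_upper_rate:
  assumes \<epsilon>: "0 < \<epsilon>"
  shows "lower_rate d M m A \<epsilon> \<le> upper_rate d M m A \<epsilon>"
  unfolding lower_rate_def upper_rate_def
proof (intro Limsup_mono always_eventually allI)
  fix n
  have "words m n \<noteq> {}"
    using card_words[of m n] m_ge_1 by (metis card.empty not_one_le_zero power_eq_0_iff)
  moreover have "0 < 1 / measure M (D_set d w \<epsilon> A)" if "w \<in> words m n" for w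
    using D_set_pos[OF set_words[OF that] \<epsilon>] by simp
  ultimately have "1 / real m ^ n * (\<Sum>w\<in>words m n. ln (1 / measure M (D_set d w \<epsilon> A)))
      \<le> ln (1 / real m ^ n * (\<Sum>w\<in>words m n. 1 / measure M (D_set d w \<epsilon> A)))"
    using mean_ln_le_ln_mean[OF finite_words, of m n "\<lambda>w. 1 / measure M (D_set d w \<epsilon> A)"]
    unfolding card_words of_nat_power by blast
  then show "ereal (1 / real n * (1 / real m ^ n * (\<Sum>w\<in>words m n. ln (1 / measure M (D_set d w \<epsilon> A)))))
      \<le> ereal (1 / real n * ln (1 / real m ^ n * (\<Sum>w\<in>words m n. 1 / measure M (D_set d w \<epsilon> A))))"
    by (intro iffD2[OF ereal_less_eq(3)] mult_left_mono) auto
qed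

lemma limsup_mean_entropy:
  assumes "finite_measurable_partition M \<xi>"
  shows "limsup (\<lambda>n. ereal (1 / real n * mean_entropy (block_of \<xi>) n)) = ereal (semigroup_entropy_wrt M m g \<xi>)"
  by (intro lim_imp_Limsup trivial_limit_sequentially tendsto_ereal semigroup_entropy_wrt_tendsto assms)

lemma lower_rate_le_semigroup_entropy:
  assumes \<epsilon>: "0 < \<epsilon>"
  shows "lower_rate d M m A \<epsilon> \<le> semigroup_entropy M m g"
proof -
  obtain X :: "'a \<Rightarrow> 'a" where X: "simple_function M X" "\<And>x y. X x = X y \<Longrightarrow> d x y < \<epsilon>"
    using fine_label[OF sets_M \<epsilon>] by metis
  obtain \<xi> where \<xi>: "finite_measurable_partition M \<xi>"
      "\<And>x y. x \<in> space M \<Longrightarrow> y \<in> space M \<Longrightarrow> block_of \<xi> x = block_of \<xi> y \<longleftrightarrow> X x = X y"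
    using partition_of_label[OF X(1)] by metis
  have block: "simple_function M (block_of \<xi>)"
    by (rule simple_function_block_of[OF \<xi>(1)])
  have fine: "d x y < \<epsilon>" if "block_of \<xi> x = block_of \<xi> y" for x y
    using that \<xi>(2)[of x y] X(2)[of x y] by (simp add: space_M)
  have "lower_rate d M m A \<epsilon> \<le> limsup (\<lambda>n. ereal (1 / real n * mean_entropy (block_of \<xi>) n))"
    unfolding lower_rate_def mean_entropy_def
    by (intro Limsup_mono always_eventually allI iffD2[OF ereal_less_eq(3)] mult_left_mono sum_mono
        shannon_entropy_itinerary_ge[OF block fine set_words]) auto
  also have "\<dots> = ereal (semigroup_entropy_wrt M m g \<xi>)"
    by (rule limsup_mean_entropy[OF \<xi>(1)])
  also have "\<dots> \<le> semigroup_entropy M m g"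
    unfolding semigroup_entropy_def using \<xi>(1) by (intro SUP_upper) auto
  finally show ?thesis .
qed

lemma semigroup_entropy_le_SUP_lower_rate:
  "semigroup_entropy M m g \<le> (SUP \<epsilon>\<in>{0<..}. lower_rate d M m A \<epsilon>)"
  unfolding semigroup_entropy_def
proof (rule SUP_least)
  fix \<xi> :: "'a set set"
  assume "\<xi> \<in> {\<xi>. finite_measurable_partition M \<xi>}"
  then have \<xi>: "finite_measurable_partition M \<xi>"
    by simp
  show "ereal (semigroup_entropy_wrt M m g \<xi>) \<le> (SUP \<epsilon>\<in>{0<..}. lower_rate d M m A \<epsilon>)"
  proof (rule ereal_le_epsilon2)
    fix \<kappa> :: real
    assume \<kappa>: "0 < \<kappa>"
    obtain r where r: "r > 0"
      "\<And>w. set w \<subseteq> {..<m} \<Longrightarrow> shannon_entropy M (itinerary g (block_of \<xi>) w)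
          \<le> ln (1 / measure M (D_set d w r A)) + real (length w) * \<kappa>"
      using shannon_entropy_itinerary_block_le[OF \<xi> \<kappa>] by metis
    let ?l = "\<lambda>n. 1 / real n * (1 / real m ^ n * (\<Sum>w\<in>words m n. ln (1 / measure M (D_set d w r A))))"
    have le: "1 / real n * mean_entropy (block_of \<xi>) n \<le> ?l n + \<kappa>" if "n \<ge> 1" for n
    proof -
      have "mean_entropy (block_of \<xi>) n
          \<le> 1 / real m ^ n * (\<Sum>w\<in>words m n. ln (1 / measure M (D_set d w r A)) + real n * \<kappa>)"
        unfolding mean_entropy_def
      proof (intro mult_left_mono sum_mono)
        fix w assume "w \<in> words m n"
        then show "shannon_entropy M (itinerary g (block_of \<xi>) w)
            \<le> ln (1 / measure M (D_set d w r A)) + real n * \<kappa>"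
          using r(2)[of w] by (simp add: words_def)
      qed simp
      also have "\<dots> = 1 / real m ^ n * (\<Sum>w\<in>words m n. ln (1 / measure M (D_set d w r A))) + real n * \<kappa>"
        using m_ge_1 by (simp add: sum.distrib card_words algebra_simps)
      finally have "1 / real n * mean_entropy (block_of \<xi>) n
          \<le> 1 / real n * (1 / real m ^ n * (\<Sum>w\<in>words m n. ln (1 / measure M (D_set d w r A))) + real n * \<kappa>)"
        by (rule mult_left_mono) simp
      then show ?thesis
        using that by (simp add: distrib_left)
    qed
    have "ereal (semigroup_entropy_wrt M m g \<xi>)
        = limsup (\<lambda>n. ereal (1 / real n * mean_entropy (block_of \<xi>) n))"
      by (rule limsup_mean_entropy[OF \<xi>, symmetric])
    also have "\<dots> \<le> limsup (\<lambda>n. ereal (?l n) + ereal \<kappa>)"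
    proof (rule Limsup_mono)
      show "\<forall>\<^sub>F n in sequentially. ereal (1 / real n * mean_entropy (block_of \<xi>) n) \<le> ereal (?l n) + ereal \<kappa>"
        using eventually_ge_at_top[of 1]
      proof eventually_elim
        case (elim n)
        show ?case
          unfolding plus_ereal.simps(1) ereal_less_eq(3) by (rule le[OF elim])
      qed
    qed
    also have "\<dots> = lower_rate d M m A r + ereal \<kappa>"
      unfolding lower_rate_def by (rule Limsup_add_ereal_right) auto
    also have "\<dots> \<le> (SUP \<epsilon>\<in>{0<..}. lower_rate d M m A \<epsilon>) + ereal \<kappa>"
      using r(1) by (intro add_right_mono SUP_upper) auto
    finally show "ereal (semigroup_entropy_wrt M m g \<xi>) \<le> (SUP \<epsilon>\<in>{0<..}. lower_rate d M m A \<epsilon>) + ereal \<kappa>" .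
  qed
qed

text \<open>
  The lower bound of the theorem is an equality: fine partitions give one direction and the
  estimate for arbitrary partitions the other, since its error \<open>\<kappa>\<close> is arbitrary.
\<close>

lemma semigroup_entropy_eq_SUP_lower_rate:
  "semigroup_entropy M m g = (SUP \<epsilon>\<in>{0<..}. lower_rate d M m A \<epsilon>)"
proof (rule antisym)
  show "(SUP \<epsilon>\<in>{0<..}. lower_rate d M m A \<epsilon>) \<le> semigroup_entropy M m g"
    by (rule SUP_least) (simp add: lower_rate_le_semigroup_entropy)
qed (rule semigroup_entropy_le_SUP_lower_rate)

lemma SUP_lower_rate_le_SUP_upper_rate:
  "(SUP \<epsilon>\<in>{0<..}. lower_rate d M m A \<epsilon>) \<le> (SUP \<epsilon>\<in>{0<..}. upper_rate d M m A \<epsilon>)"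
  by (rule SUP_subset_mono) (auto intro: lower_rate_le_upper_rate)

end

theorem theorem6p1:
  fixes A :: "nat \<Rightarrow> 'a::{topological_group_add, metric_space} \<Rightarrow> 'a"
    and a :: "nat \<Rightarrow> 'a"
    and g :: "nat \<Rightarrow> 'a \<Rightarrow> 'a"
    and m :: nat
    and \<mu> :: "'a measure"
    and d :: "'a \<Rightarrow> 'a \<Rightarrow> real"
  assumes "compact (UNIV :: 'a set)"
    and "m \<ge> 1"
    and "\<And>i. i < m \<Longrightarrow> group_endomorphism (A i)"
    and "\<And>i. i < m \<Longrightarrow> surj (A i)"
    and "normalised_haar \<mu>"
    and "left_invariant_metric d"
    and "\<And>i x. i < m \<Longrightarrow> g i x = a i + A i x"
  shows "\<exists>L U :: ereal.
           (lower_rate d \<mu> m A \<longlongrightarrow> L) (at_right 0) \<and>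
           (upper_rate d \<mu> m A \<longlongrightarrow> U) (at_right 0) \<and>
           L \<le> semigroup_entropy \<mu> m g \<and> semigroup_entropy \<mu> m g \<le> U \<and>
           L \<le> semigroup_entropy \<mu> m A \<and> semigroup_entropy \<mu> m A \<le> U"
proof -
  interpret translated: affine_action d A a g m \<mu>
    by unfold_locales (rule assms; assumption?)+
  \<comment> \<open>The endomorphisms themselves are the affine maps with trivial translations.\<close>
  interpret untranslated: affine_action d A "\<lambda>_. 0" A m \<mu>
    by unfold_locales ((rule assms; assumption?) | simp)+
  let ?L = "SUP \<epsilon>\<in>{0<..}. lower_rate d \<mu> m A \<epsilon>"
  let ?U = "SUP \<epsilon>\<in>{0<..}. upper_rate d \<mu> m A \<epsilon>"
  have "(lower_rate d \<mu> m A \<longlongrightarrow> ?L) (at_right 0)"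
    by (rule tendsto_at_right_0_of_antimono) (rule translated.lower_rate_antimono)
  moreover have "(upper_rate d \<mu> m A \<longlongrightarrow> ?U) (at_right 0)"
    by (rule tendsto_at_right_0_of_antimono) (rule translated.upper_rate_antimono)
  moreover have "semigroup_entropy \<mu> m g = ?L" "semigroup_entropy \<mu> m A = ?L"
    by (rule translated.semigroup_entropy_eq_SUP_lower_rate untranslated.semigroup_entropy_eq_SUP_lower_rate)+
  moreover have "?L \<le> ?U"
    by (rule translated.SUP_lower_rate_le_SUP_upper_rate)
  ultimately show ?thesis
    by (intro exI[of _ ?L] exI[of _ ?U]) simp
qed

end
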